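(* Let $N\geq 3$, let $D=\{\delta_1,\ldots,\delta_N\}\subset(0,1)$ with $\delta_i\neq\delta_j$ for $i\neq j$, and let $\succeq$ be a weak order on $\ell_\infty$. The following conditions are equivalent. (i) The relation $\succeq$ satisfies D-monotonicity (parts (a) and (b)), Continuity, Convexity (parts (a) and (b)), Invariance with respect to unconcerned individuals, and Invariance of preference-increasing direction with respect to generation $0$'s origin. (ii) There exist a strictly concave, strictly increasing, and differentiable function $u:\mathbb{R}\to\mathbb{R}$ and a probability measure $\mu\in\Delta_{++}(D)$ such that for all $x,y\in\ell_\infty$, $$x\succeq y\iff \sum_{\delta\in D}u(\langle\delta,x\rangle)\mu(\delta)\geq\sum_{\delta\in D}u(\langle\delta,y\rangle)\mu(\delta).$$
   Context: $\mathbb{T}=\{0,1,2,\ldots\}$. $\ell_\infty$ is the space of bounded real sequences $x=(x_t)_{t\in\mathbb{T}}$ with the supremum norm $\|x\|_\infty=\sup_t|x_t|$. For $\delta\in(0,1)$, $\langle\delta,x\rangle=\sum_{t\in\mathbb{T}}\delta^t x_t$. A weak order is a complete and transitive binary relation; $\succ$ and $\sim$ are the asymmetric and symmetric parts of $\succeq$. Let $\ell_\infty^0=\{(z_0,z_1,\ldots)\in\ell_\infty: z_t=0\ \forall t\geq 1\}$. $\Delta_{++}(D)$ is the set of probability measures $\mu$ on $D$ with $\mu(\delta)>0$ for every $\delta\in D$. For $E\subset D$, $E^c=D\setminus E$. Axioms: - D-monotonicity: for all $x,y\in\ell_\infty$, (a) if $\langle\delta,x\rangle\geq\langle\delta,y\rangle$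 for all $\delta\in D$, then $x\succeq y$; and (b) if, additionally, $\langle\delta,x\rangle>\langle\delta,y\rangle$ for some $\delta\in D$, then $x\succ y$. - Continuity: for every $x\in\ell_\infty$, the sets $\{z\in\ell_\infty: z\succeq x\}$ and $\{z\in\ell_\infty: x\succeq z\}$ are closed. - Convexity: (a) for all $x,y\in\ell_\infty$, if $x\sim y$, then $\alpha x+(1-\alpha)y\succeq x$ for every $\alpha\in[0,1]$; and (b) there exist $x',y'\in\ell_\infty$ with $x'\sim y'$ and $\alpha x'+(1-\alpha)y'\succ x'$ for some $\alpha\in(0,1)$. - Invariance with respect to unconcerned individuals: for any $x,y,x',y'\in\ell_\infty$ and any subset $E\subset D$, if $\langle\delta,x\rangle=\langle\delta,x'\rangle$ and $\langle\delta,y\rangle=\langle\delta,y'\rangle$ for all $\delta\in E$, and $\langle\delta,x\rangle=\langle\delta,y\rangle$ and $\langle\delta,x'\rangle=\langle\delta,y'\rangle$ for all $\delta\in E^c$, then $x\succeq y$ if and only if $x'\succeq y'$. - Invariance of preference-increasing direction with respect to generation $0$'s origin: for every $x\in\ell_\infty$, if $\alpha x+z^0\succeq z^0$ for some $\alpha>0$ and some $z^0\in\ell_\infty^0$, then for any other $z^{0'}\in\ell_\infty^0$ there exists $\alpha'>0$ such that $\alpha' x+z^{0'}\succeq z^{0'}$. *)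

theory Defs
  imports
    "HOL-Analysis.Analysis"
    "HOL-Probability.Probability_Mass_Function"
begin

text \<open>
  Every function on \<^typ>\<open>nat\<close> is continuous, so bounded continuous functions on
  \<^typ>\<open>nat\<close> are exactly the bounded sequences; the library equips them with the
  supremum norm.
\<close>

type_synonym linf = "nat \<Rightarrow>\<^sub>C real"

lemma linf_iff_bounded: "(x :: nat \<Rightarrow> real) \<in> bcontfun \<longleftrightarrow> bounded (range x)"
  by (simp add: bcontfun_def)

lemma norm_linf: "norm (x :: linf) = (SUP t. \<bar>apply_bcontfun x t\<bar>)"
  by (simp add: norm_bcontfun_def dist_bcontfun.rep_eq)

definition disc_sum :: "real \<Rightarrow> linf \<Rightarrow> real" where
  "disc_sum \<delta> x = (\<Sum>t. \<delta> ^ t * apply_bcontfun x t)"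

text \<open>The series above converges for the discount factors of interest.\<close>

lemma summable_disc_sum:
  assumes "\<delta> \<in> {0<..<1}"
  shows "summable (\<lambda>t. \<delta> ^ t * apply_bcontfun (x :: linf) t)"
proof (rule summable_comparison_test')
  show "summable (\<lambda>t. \<delta> ^ t * norm x)"
    using assms by (intro summable_mult2 summable_geometric) auto
  show "norm (\<delta> ^ t * apply_bcontfun x t) \<le> \<delta> ^ t * norm x" for t
    using assms norm_bounded[of x t]
    by (auto simp: abs_mult power_abs intro!: mult_left_mono)
qed

definition linf0 :: "linf set" where
  "linf0 = {z. \<forall>t\<ge>1. apply_bcontfun z t = 0}"

definition weak_order :: "('a \<Rightarrow> 'a \<Rightarrow> bool) \<Rightarrow> bool" where
  "weak_order R \<longleftrightarrow> (\<forall>x y. R x y \<or> R y x) \<and> (\<forall>x y z. R x y \<longrightarrow> R y z \<longrightarrow> R x z)"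

definition strict_part :: "('a \<Rightarrow> 'a \<Rightarrow> bool) \<Rightarrow> 'a \<Rightarrow> 'a \<Rightarrow> bool" where
  "strict_part R x y \<longleftrightarrow> R x y \<and> \<not> R y x"

definition indiff_part :: "('a \<Rightarrow> 'a \<Rightarrow> bool) \<Rightarrow> 'a \<Rightarrow> 'a \<Rightarrow> bool" where
  "indiff_part R x y \<longleftrightarrow> R x y \<and> R y x"

definition D_monotonicity :: "real set \<Rightarrow> (linf \<Rightarrow> linf \<Rightarrow> bool) \<Rightarrow> bool" where
  "D_monotonicity D R \<longleftrightarrow> (\<forall>x y. (\<forall>\<delta>\<in>D. disc_sum \<delta> x \<ge> disc_sum \<delta> y) \<longrightarrow>
     R x y \<and> ((\<exists>\<delta>\<in>D. disc_sum \<delta> x > disc_sum \<delta> y) \<longrightarrow> strict_part R x y))"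

definition pref_continuity :: "(linf \<Rightarrow> linf \<Rightarrow> bool) \<Rightarrow> bool" where
  "pref_continuity R \<longleftrightarrow> (\<forall>x. closed {z. R z x} \<and> closed {z. R x z})"

definition pref_convexity :: "(linf \<Rightarrow> linf \<Rightarrow> bool) \<Rightarrow> bool" where
  "pref_convexity R \<longleftrightarrow>
     (\<forall>x y. indiff_part R x y \<longrightarrow>
        (\<forall>\<alpha>\<in>{0..1}. R (\<alpha> *\<^sub>R x + (1 - \<alpha>) *\<^sub>R y) x)) \<and>
     (\<exists>x y. indiff_part R x y \<and>
        (\<exists>\<alpha>\<in>{0<..<1}. strict_part R (\<alpha> *\<^sub>R x + (1 - \<alpha>) *\<^sub>R y) x))"

definition inv_unconcerned :: "real set \<Rightarrow> (linf \<Rightarrow> linf \<Rightarrow> bool) \<Rightarrow> bool" where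
  "inv_unconcerned D R \<longleftrightarrow> (\<forall>x y x' y'. \<forall>E\<subseteq>D.
     (\<forall>\<delta>\<in>E. disc_sum \<delta> x = disc_sum \<delta> x' \<and> disc_sum \<delta> y = disc_sum \<delta> y') \<longrightarrow>
     (\<forall>\<delta>\<in>D - E. disc_sum \<delta> x = disc_sum \<delta> y \<and> disc_sum \<delta> x' = disc_sum \<delta> y') \<longrightarrow>
     (R x y \<longleftrightarrow> R x' y'))"

definition inv_direction_origin0 :: "(linf \<Rightarrow> linf \<Rightarrow> bool) \<Rightarrow> bool" where
  "inv_direction_origin0 R \<longleftrightarrow> (\<forall>x.
     (\<exists>\<alpha>>0. \<exists>z\<in>linf0. R (\<alpha> *\<^sub>R x + z) z) \<longrightarrow>
     (\<forall>z'\<in>linf0. \<exists>\<alpha>'>0. R (\<alpha>' *\<^sub>R x + z') z'))"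

definition strictly_concave :: "(real \<Rightarrow> real) \<Rightarrow> bool" where
  "strictly_concave u \<longleftrightarrow> (\<forall>a b. \<forall>\<alpha>\<in>{0<..<1}. a \<noteq> b \<longrightarrow>
     u (\<alpha> * a + (1 - \<alpha>) * b) > \<alpha> * u a + (1 - \<alpha>) * u b)"

definition full_support_measures :: "'a set \<Rightarrow> 'a pmf set" where
  "full_support_measures D = {\<mu>. set_pmf \<mu> \<subseteq> D \<and> (\<forall>\<delta>\<in>D. pmf \<mu> \<delta> > 0)}"

end

theory Submission
  imports Defs
begin

text \<open>
  The vectors of discounted sums \<open>(\<langle>\<delta>, x\<rangle>)\<^sub>\<delta>\<close> fill all of \<open>\<real>\<^sup>D\<close> (Lagrange interpolation), so the
  axioms describe a monotone, continuous, convex and separable preference there. Convexity makes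
  every gain compensable by a loss in any other coordinate. Hence below each constant vector, losses
  form a total Archimedean monoid under aggregation, Hoelder's theorem gives an additive
  representation \<open>\<Sum> f\<^sub>i(X\<^sub>i)\<close>, and uniqueness up to scale glues these representations together.

  The sequences in \<open>\<ell>\<^sub>\<infinity>\<^sup>0\<close> become the constant vectors, so the last axiom says that the cone of
  improving directions is the same at all points of the diagonal. At a point where two concave
  summands are differentiable this cone is a half-plane in the two coordinates; transporting it
  along the diagonal makes their supergradients proportional, hence unique, everywhere. At most one
  summand can fail to be concave, and the same half-plane forces the Dini derivatives of that
  summand to be proportional as well. So \<open>f\<^sub>i = \<mu>\<^sub>i u + const\<close> with \<open>u\<close> concave and differentiable. If
  \<open>u\<close> were affine on an interval, invariance of the cone would make it affine everywhere,
  contradicting part (b) of Convexity.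
\<close>

section \<open>Archimedean monoids on the nonnegative reals\<close>

text \<open>These are the hypotheses of Hoelder's theorem for a monoid on the nonnegative reals with
  their usual order. The guards are there because \<open>oper\<close> is a total function on all
  reals.\<close>

locale archimedean_monoid =
  fixes oper :: "real \<Rightarrow> real \<Rightarrow> real"  (infixl "\<diamondop>" 65)
  assumes op_closed: "0 \<le> a \<Longrightarrow> 0 \<le> b \<Longrightarrow> 0 \<le> a \<diamondop> b"
    and op_comm: "0 \<le> a \<Longrightarrow> 0 \<le> b \<Longrightarrow> a \<diamondop> b = b \<diamondop> a"
    and op_assoc: "0 \<le> a \<Longrightarrow> 0 \<le> b \<Longrightarrow> 0 \<le> c \<Longrightarrow> a \<diamondop> b \<diamondop> c = a \<diamondop> (b \<diamondop> c)"
    and op_zero: "0 \<le> a \<Longrightarrow> a \<diamondop> 0 = a"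
    and op_strict: "0 \<le> a \<Longrightarrow> a < b \<Longrightarrow> 0 \<le> c \<Longrightarrow> a \<diamondop> c < b \<diamondop> c"
    and op_diff: "0 \<le> a \<Longrightarrow> a \<le> b \<Longrightarrow> \<exists>c\<ge>0. b = a \<diamondop> c"
    and op_archimedean: "0 < a \<Longrightarrow> \<exists>n. b \<le> ((\<lambda>x. x \<diamondop> a) ^^ n) 0"
begin

definition mult :: "nat \<Rightarrow> real \<Rightarrow> real" where
  "mult n a = ((\<lambda>x. x \<diamondop> a) ^^ n) 0"

lemma mult_0 [simp]: "mult 0 a = 0"
  and mult_Suc: "mult (Suc n) a = mult n a \<diamondop> a"
  by (simp_all add: mult_def)

lemma mult_nonneg [simp]: "0 \<le> a \<Longrightarrow> 0 \<le> mult n a"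
  by (induction n) (auto simp: mult_Suc op_closed)

lemma mult_1 [simp]: "0 \<le> a \<Longrightarrow> mult (Suc 0) a = a"
  using op_comm[of 0 a] by (simp add: mult_Suc op_zero)

lemma op_mono:
  assumes "0 \<le> a" "a \<le> b" "0 \<le> c" "c \<le> d"
  shows "a \<diamondop> c \<le> b \<diamondop> d"
proof -
  have "a \<diamondop> c \<le> b \<diamondop> c" using op_strict[of a b c] assms by (cases "a = b") auto
  also have "b \<diamondop> c = c \<diamondop> b" using assms by (intro op_comm) auto
  also have "\<dots> \<le> d \<diamondop> b" using op_strict[of c d b] assms by (cases "c = d") auto
  also have "\<dots> = b \<diamondop> d" using assms by (intro op_comm) auto
  finally show ?thesis .
qed

lemma mult_add: "0 \<le> a \<Longrightarrow> mult (m + n) a = mult m a \<diamondop> mult n a"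
  by (induction n) (simp_all add: mult_Suc op_zero op_assoc)

lemma mult_op: "0 \<le> a \<Longrightarrow> 0 \<le> b \<Longrightarrow> mult n (a \<diamondop> b) = mult n a \<diamondop> mult n b"
proof (induction n)
  case (Suc n)
  let ?x = "mult n a" and ?y = "mult n b"
  have nn: "0 \<le> ?x" "0 \<le> ?y" using Suc.prems by auto
  have "?x \<diamondop> ?y \<diamondop> (a \<diamondop> b) = ?x \<diamondop> (?y \<diamondop> a \<diamondop> b)"
    using nn Suc.prems by (simp add: op_assoc op_closed)
  also have "?y \<diamondop> a = a \<diamondop> ?y" using nn Suc.prems by (intro op_comm)
  also have "?x \<diamondop> (a \<diamondop> ?y \<diamondop> b) = ?x \<diamondop> a \<diamondop> (?y \<diamondop> b)"
    using nn Suc.prems by (simp add: op_assoc op_closed)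
  finally show ?case using Suc by (simp add: mult_Suc)
qed (simp add: op_zero)

lemma mult_mult: "0 \<le> a \<Longrightarrow> mult (m * n) a = mult m (mult n a)"
  by (induction m) (simp_all add: mult_Suc mult_add op_comm add.commute)

lemma mult_mono: "0 \<le> a \<Longrightarrow> a \<le> b \<Longrightarrow> mult n a \<le> mult n b"
  by (induction n) (simp_all add: mult_Suc op_mono)

lemma mult_strict_left: "0 < a \<Longrightarrow> m < n \<Longrightarrow> mult m a < mult n a"
proof (induction n)
  case (Suc n)
  have "mult n a < mult n a \<diamondop> a"
    using op_strict[of 0 a "mult n a"] Suc.prems
    by (metis less_imp_le mult_nonneg op_comm op_zero order_refl)
  with Suc show ?case by (cases "m = n") (auto simp: mult_Suc)
qed simp

lemma mult_le_iff: "0 < a \<Longrightarrow> mult m a \<le> mult n a \<longleftrightarrow> m \<le> n"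
  by (metis less_imp_le mult_strict_left linorder_not_less order_refl order_le_less)

section \<open>Hoelder's embedding and its uniqueness\<close>

text \<open>The lower Dedekind cut of the ratio of \<open>a\<close> to the unit 1, in the sense of
  Eudoxus: \<open>m\<close> copies of 1 do not exceed \<open>n\<close> copies of \<open>a\<close>.
  Its supremum is Hoelder's embedding.\<close>

definition ratios :: "real \<Rightarrow> real set" where
  "ratios a = {real m / real n | m n. n > 0 \<and> mult m 1 \<le> mult n a}"

definition embed :: "real \<Rightarrow> real" where
  "embed a = Sup (ratios a)"

text \<open>Cross-multiplication inside the monoid: \<open>n * i\<close> copies of 1 are at most
  \<open>n * k\<close> copies of \<open>a\<close>, which are at most \<open>k * m\<close> copies of
  1.\<close>

lemma ratios_le:
  assumes "0 \<le> a" "n > 0" "mult n a \<le> mult m 1" "s \<in> ratios a"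
  shows "s \<le> real m / real n"
proof -
  obtain i k where s: "s = real i / real k" "k > 0" "mult i 1 \<le> mult k a"
    using assms by (auto simp: ratios_def)
  have "mult (n * i) 1 \<le> mult (n * k) a"
    using s by (simp add: mult_mult mult_mono assms)
  also have "\<dots> = mult (k * n) a" by (simp add: mult.commute)
  also have "\<dots> \<le> mult (k * m) 1"
    using assms by (simp add: mult_mult mult_mono)
  finally have "n * i \<le> k * m" by (simp add: mult_le_iff)
  then have "real n * real i \<le> real k * real m" by (metis of_nat_le_iff of_nat_mult)
  then have "real i / real k \<le> real m / real n" using s assms by (simp add: field_simps)
  then show ?thesis using s by simp
qed

lemma ex_bracket:
  assumes "0 \<le> a"
  shows "\<exists>m. mult m 1 \<le> a \<and> a < mult (Suc m) 1"
proof -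
  obtain n where "a \<le> mult n 1" using op_archimedean[of 1 a] by (auto simp: mult_def)
  \<comment> \<open>The Archimedean property gives a weak inequality; one further copy of 1 makes it
    strict.\<close>
  then have ex: "\<exists>n. a < mult n 1"
    using mult_strict_left[of 1 n "Suc n"] by (intro exI[of _ "Suc n"]) auto
  define n where "n = (LEAST n. a < mult n 1)"
  have n: "a < mult n 1" unfolding n_def using ex by (rule LeastI_ex)
  with assms have "n \<noteq> 0" by (metis mult_0 linorder_not_less)
  then obtain m where m: "n = Suc m" by (cases n) auto
  have "\<not> a < mult m 1" using not_less_Least[of m "\<lambda>n. a < mult n 1"] m n_def by simp
  with n m show ?thesis by (intro exI[of _ m]) auto
qed

lemma embed_le:
  assumes "0 \<le> a" "n > 0" "mult n a \<le> mult m 1"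
  shows "embed a \<le> real m / real n"
  unfolding embed_def
proof (rule cSup_least)
  have "0 \<in> ratios a"
    unfolding ratios_def using assms by (intro CollectI exI[of _ 0] exI[of _ "Suc 0"]) auto
  then show "ratios a \<noteq> {}" by blast
qed (use ratios_le assms in blast)

lemma le_embed:
  assumes "0 \<le> a" "n > 0" "mult m 1 \<le> mult n a"
  shows "real m / real n \<le> embed a"
  unfolding embed_def
proof (rule cSup_upper)
  show "real m / real n \<in> ratios a" using assms by (auto simp: ratios_def)
  obtain k where "a < mult (Suc k) 1" using ex_bracket assms by blast
  then show "bdd_above (ratios a)"
    using ratios_le[of a 1 "Suc k"] assms by (intro bdd_aboveI) auto
qed

text \<open>Bracket \<open>n\<close> copies of \<open>a\<close> and of \<open>b\<close> between
  consecutive multiples of 1. Adding the brackets puts both sides into one interval of length 2/n,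
  for every \<open>n\<close>.\<close>

lemma embed_op:
  assumes "0 \<le> a" "0 \<le> b"
  shows "embed (a \<diamondop> b) = embed a + embed b"
proof -
  have "\<bar>embed (a \<diamondop> b) - (embed a + embed b)\<bar> \<le> 2 * inverse (real (Suc N))" for N
  proof -
    define n where "n = Suc N"
    have n: "n > 0" by (simp add: n_def)
    obtain k where k: "mult k 1 \<le> mult n a" "mult n a < mult (Suc k) 1"
      using ex_bracket[of "mult n a"] assms by auto
    obtain l where l: "mult l 1 \<le> mult n b" "mult n b < mult (Suc l) 1"
      using ex_bracket[of "mult n b"] assms by auto
    have lo: "mult (k + l) 1 \<le> mult n (a \<diamondop> b)"
      using k l assms by (simp add: mult_add mult_op op_mono)
    have hi: "mult n (a \<diamondop> b) \<le> mult (Suc k + Suc l) 1"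
      using k l assms by (simp add: mult_add[of 1 "Suc k" "Suc l"] mult_op op_mono del: add_Suc add_Suc_right)
    have "real k / n \<le> embed a" "embed a \<le> real (Suc k) / n"
         "real l / n \<le> embed b" "embed b \<le> real (Suc l) / n"
         "real (k + l) / n \<le> embed (a \<diamondop> b)" "embed (a \<diamondop> b) \<le> real (Suc k + Suc l) / n"
      using k l lo hi n assms
      by (intro le_embed embed_le; simp add: op_closed less_imp_le del: add_Suc add_Suc_right)+
    then have "\<bar>embed (a \<diamondop> b) - (embed a + embed b)\<bar> \<le> 2 / real n"
      by (simp add: add_divide_distrib abs_le_iff)
    then show ?thesis by (simp add: n_def field_simps)
  qed
  then have "\<bar>embed (a \<diamondop> b) - (embed a + embed b)\<bar> \<le> 0"
    using LIMSEQ_inverse_real_of_nat[THEN tendsto_mult_left[of _ _ _ 2]]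
    by (intro LIMSEQ_le_const[of "\<lambda>n. 2 * inverse (real (Suc n))"]) auto
  then show ?thesis by simp
qed

text \<open>Write \<open>b\<close> as \<open>a\<close> combined with some \<open>c > 0\<close>. By
  the Archimedean property \<open>n\<close> copies of \<open>c\<close> reach 1, so
  \<open>embed c\<close> is at least 1/n, and additivity finishes.\<close>

lemma embed_strict_mono:
  assumes "0 \<le> a" "a < b"
  shows "embed a < embed b"
proof -
  obtain c where c: "c \<ge> 0" "b = a \<diamondop> c" using op_diff[of a b] assms by auto
  with assms have "c > 0" using op_zero[of a] by (cases "c = 0") auto
  then obtain n where "1 \<le> mult n c" using op_archimedean[of c 1] by (auto simp: mult_def)
  moreover from this have "n > 0" by (cases n) auto
  ultimately have "1 / real n \<le> embed c" using le_embed[of c n 1] c by simp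
  with \<open>n > 0\<close> have "0 < embed c" by (smt (verit) divide_pos_pos of_nat_0_less_iff)
  then show ?thesis using c assms by (simp add: embed_op)
qed

text \<open>An additive increasing \<open>h\<close> turns the brackets of \<open>n\<close> copies of
  \<open>a\<close> by multiples of 1 into brackets of \<open>h a / h 1\<close> of width 1/n, and
  these contain \<open>embed a\<close> as well.\<close>

lemma embed_unique:
  assumes add: "\<And>a b. 0 \<le> a \<Longrightarrow> 0 \<le> b \<Longrightarrow> h (a \<diamondop> b) = h a + h b"
    and mono: "\<And>a b. 0 \<le> a \<Longrightarrow> a < b \<Longrightarrow> h a < (h b :: real)"
    and "0 \<le> a"
  shows "h a = h 1 * embed a"
proof -
  have h0: "h 0 = 0" using add[of 0 0] by (simp add: op_zero)
  have h1: "h 1 > 0" using mono[of 0 1] h0 by simp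
  have hm: "h (mult n b) = real n * h b" if "0 \<le> b" for n b
    using that by (induction n) (auto simp: h0 mult_Suc add algebra_simps)
  have le: "h x \<le> h y" if "0 \<le> x" "x \<le> y" for x y
    using mono[of x y] that by (cases "x = y") auto
  have "\<bar>h a / h 1 - embed a\<bar> \<le> inverse (real (Suc N))" for N
  proof -
    define n where "n = Suc N"
    have n: "n > 0" by (simp add: n_def)
    obtain k where k: "mult k 1 \<le> mult n a" "mult n a < mult (Suc k) 1"
      using ex_bracket[of "mult n a"] assms by auto
    have 1: "real k / n \<le> embed a" "embed a \<le> real (Suc k) / n"
      using k n assms by (intro le_embed embed_le; simp)+
    have "h (mult k 1) \<le> h (mult n a)" "h (mult n a) \<le> h (mult (Suc k) 1)"
      using k assms by (auto intro!: le)
    then have "real k * h 1 \<le> n * h a" "n * h a \<le> real (Suc k) * h 1"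
      by (simp_all only: hm assms zero_le_one)
    then have "real k / n \<le> h a / h 1" "h a / h 1 \<le> real (Suc k) / n"
      using h1 n by (simp_all add: field_simps)
    with 1 have "\<bar>h a / h 1 - embed a\<bar> \<le> 1 / real n"
      by (simp add: add_divide_distrib abs_le_iff)
    then show ?thesis by (simp add: n_def field_simps)
  qed
  then have "\<bar>h a / h 1 - embed a\<bar> \<le> 0"
    using LIMSEQ_inverse_real_of_nat by (intro LIMSEQ_le_const) auto
  then show ?thesis using h1 by (simp add: field_simps)
qed

end

section \<open>Sums of two functions with diagonal-invariant improving directions\<close>

text \<open>For fixed \<open>e\<close> the points of [x, y] where \<open>G\<close> has dropped by at
  most \<open>e\<close> times the distance from \<open>x\<close> form a closed set. The local
  condition pushes its supremum up to \<open>y\<close>; then \<open>e\<close> tends to 0.\<close>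

lemma nondecreasing_if_right_lower_derivative_nonneg:
  fixes G :: "real \<Rightarrow> real"
  assumes cont: "continuous_on UNIV G"
    and right: "\<And>c e. 0 < e \<Longrightarrow> \<exists>d>0. \<forall>h. 0 < h \<longrightarrow> h < d \<longrightarrow> G c - e * h \<le> G (c + h)"
    and "x \<le> y"
  shows "G x \<le> G y"
proof -
  have *: "G x - e * (y - x) \<le> G y" if e: "0 < e" for e
  proof -
    let ?S = "{z. x \<le> z \<and> z \<le> y \<and> G x - e * (z - x) \<le> G z}"
    have "closed ?S" by (intro closed_Collect_conj closed_Collect_le continuous_intros cont)
    moreover have "?S \<noteq> {}" using \<open>x \<le> y\<close> by (auto intro: exI[of _ x])
    moreover have bdd: "bdd_above ?S" by (intro bdd_aboveI[of _ y]) auto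
    moreover define s where "s = Sup ?S"
    ultimately have S: "s \<in> ?S" unfolding s_def by (intro closed_contains_Sup)
    have "s = y"
    proof (rule ccontr)
      assume "s \<noteq> y"
      with S have sy: "s < y" by auto
      obtain d where d: "d > 0" "\<And>h. 0 < h \<Longrightarrow> h < d \<Longrightarrow> G s - e * h \<le> G (s + h)"
        using right[OF e, of s] by blast
      define h where "h = min (d / 2) (y - s)"
      have h: "0 < h" "h < d" "s + h \<le> y" using d sy by (auto simp: h_def)
      have "s + h \<in> ?S" using S d(2)[OF h(1,2)] h by (auto simp: algebra_simps)
      then have "s + h \<le> s" unfolding s_def using bdd by (rule cSup_upper)
      with h show False by simp
    qed
    with S show ?thesis by simp
  qed
  show ?thesis
  proof (rule field_le_epsilon)
    fix e :: real assume e: "0 < e"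
    \<comment> \<open>The summand 1 keeps the denominator positive when
      \<open>x = y\<close>.\<close>
    have "e / (y - x + 1) * (y - x) \<le> e" using e \<open>x \<le> y\<close> by (simp add: field_simps)
    moreover have "G x - e / (y - x + 1) * (y - x) \<le> G y" using e \<open>x \<le> y\<close> by (intro *) auto
    ultimately show "G x \<le> G y + e" by linarith
  qed
qed

text \<open>The point \<open>p\<close> is the last minimiser of \<open>f\<close> minus the chord over which concavity fails.\<close>

lemma not_concave_point:
  fixes f :: "real \<Rightarrow> real"
  assumes cont: "continuous_on UNIV f" and mono: "strict_mono f" and nc: "\<not> concave_on UNIV f"
  shows "\<exists>p k e. 0 < k \<and> 0 < e \<and>
    (\<forall>h. 0 < h \<longrightarrow> h < e \<longrightarrow> f p + k * h < f (p + h) \<and> f p - k * h \<le> f (p - h))"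
proof -
  have "\<exists>x y u v. x < y \<and> 0 \<le> u \<and> 0 \<le> v \<and> u + v = 1 \<and> f (u * x + v * y) < u * f x + v * f y"
  proof -
    obtain x y u v where *: "0 \<le> u" "0 \<le> v" "u + v = 1" "f (u * x + v * y) < u * f x + v * f y"
      using nc by (auto simp: concave_on_iff not_le)
    have "x \<noteq> y" using * by (auto simp flip: distrib_right)
    then consider "x < y" | "y < x" by linarith
    then show ?thesis
    proof cases
      case 2
      then show ?thesis using * by (intro exI[of _ y] exI[of _ x] exI[of _ v] exI[of _ u]) (simp add: add.commute)
    qed (use * in blast)
  qed
  then obtain x y u v where xy: "x < y" and uv: "0 \<le> u" "0 \<le> v" "u + v = 1"
    and less: "f (u * x + v * y) < u * f x + v * f y" by blast
  define k where "k = (f y - f x) / (y - x)"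
  have k: "0 < k" using xy strict_monoD[OF mono xy] by (simp add: k_def)
  define w where "w z = f z - k * z" for z
  have wxy: "w y = w x"
  proof -
    have "k * (y - x) = f y - f x" using xy by (simp add: k_def)
    then show ?thesis by (simp add: w_def algebra_simps)
  qed
  define m where "m = u * x + v * y"
  have m: "m \<in> {x..y}"
    using convexD[OF convex_real_interval(5)[of x y], of x y u v] uv xy by (simp add: m_def)
  have "w m < u * w x + v * w y" using less by (simp add: w_def m_def algebra_simps)
  also have "\<dots> = w x" using uv by (simp add: wxy flip: distrib_right)
  finally have wm: "w m < w x" .
  have contw: "continuous_on A w" for A
    unfolding w_def by (intro continuous_intros continuous_on_subset[OF cont]) auto
  obtain z where z: "z \<in> {x..y}" "\<And>t. t \<in> {x..y} \<Longrightarrow> w z \<le> w t"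
    using continuous_attains_inf[of "{x..y}" w] contw m by auto
  let ?S = "{x..y} \<inter> {t. w t \<le> w z}"
  have "compact ?S"
    by (intro compact_Int_closed compact_Icc closed_Collect_le continuous_intros contw)
  moreover have "?S \<noteq> {}" using z by auto
  ultimately obtain p where p: "p \<in> ?S" "\<And>t. t \<in> ?S \<Longrightarrow> t \<le> p"
    using compact_attains_sup[of ?S] by meson
  have "w p < w x" using p z(2)[OF m] wm by auto
  then have "p \<noteq> x" "p \<noteq> y" using wxy by auto
  with p have pxy: "x < p" "p < y" by auto
  show ?thesis
  proof (rule exI[of _ p], rule exI[of _ k], rule exI[of _ "min (p - x) (y - p)"], intro conjI allI impI)
    fix h assume h: "0 < h" "h < min (p - x) (y - p)"
    \<comment> \<open>Strict on the right because \<open>p\<close> is the last minimiser of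
      \<open>w\<close>; on the left minimality gives the weak inequality.\<close>
    have "\<not> w (p + h) \<le> w z" using p(2)[of "p + h"] h pxy by auto
    moreover have "w p \<le> w z" using p by simp
    ultimately show "f p + k * h < f (p + h)" by (simp add: w_def algebra_simps)
    show "f p - k * h \<le> f (p - h)" using z(2)[of "p - h"] p h by (auto simp: w_def algebra_simps)
  qed (use k pxy in auto)
qed

section \<open>Supergradients of concave functions\<close>

definition supergradient :: "(real \<Rightarrow> real) \<Rightarrow> real \<Rightarrow> real \<Rightarrow> bool" where
  "supergradient f c s \<longleftrightarrow> (\<forall>y. f y \<le> f c + s * (y - c))"

lemma ex_supergradient:
  assumes "concave_on UNIV f"
  shows "\<exists>s. supergradient f c s"
proof -
  have "convex_on UNIV (\<lambda>x. - f x)" using assms by (simp add: concave_on_def)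
  from convex_le_Inf_differential[OF this, of c]
  obtain s where s: "\<And>y. - f c + s * (y - c) \<le> - f y" by fastforce
  have "f y \<le> f c + (- s) * (y - c)" for y using s[of y] by simp
  then show ?thesis unfolding supergradient_def by blast
qed

lemma supergradient_pos: "strict_mono f \<Longrightarrow> supergradient f c s \<Longrightarrow> 0 < s"
  using strict_monoD[of f c "c + 1"] by (auto simp: supergradient_def dest!: spec[of _ "c + 1"])

lemma supergradient_antimono:
  assumes "supergradient f x s" "supergradient f y t" "x < y"
  shows "t \<le> s"
proof -
  have "f y \<le> f x + s * (y - x)" "f x \<le> f y + t * (x - y)"
    using assms by (auto simp: supergradient_def)
  then have "t * (y - x) \<le> s * (y - x)" by (simp add: algebra_simps)
  then show ?thesis using assms by simp
qed

text \<open>The supergradients at \<open>c\<close> and at \<open>y\<close> enclose the difference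
  quotient between \<open>s c\<close> and \<open>s y\<close>, so continuity of \<open>s\<close> at
  \<open>c\<close> forces convergence.\<close>

lemma has_derivative_supergradient:
  assumes s: "\<And>c. supergradient f c (s c)" and cont: "isCont s c"
  shows "(f has_real_derivative s c) (at c)"
proof -
  have le: "norm ((f y - f c) / (y - c) - s c) \<le> \<bar>s y - s c\<bar>" if "y \<noteq> c" for y
  proof -
    have "f y \<le> f c + s c * (y - c)" "f c \<le> f y + s y * (c - y)"
      using s by (auto simp: supergradient_def)
    then have *: "f y - f c \<le> s c * (y - c)" "s y * (y - c) \<le> f y - f c"
      by (simp_all add: algebra_simps)
    show ?thesis
    proof (cases "y < c")
      case True
      with * have "s c \<le> (f y - f c) / (y - c)" "(f y - f c) / (y - c) \<le> s y"
        by (simp_all add: neg_le_divide_eq neg_divide_le_eq)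
      then show ?thesis by simp
    next
      case False
      with * that have "s y \<le> (f y - f c) / (y - c)" "(f y - f c) / (y - c) \<le> s c"
        by (simp_all add: pos_le_divide_eq pos_divide_le_eq)
      then show ?thesis by simp
    qed
  qed
  have "((\<lambda>y. \<bar>s y - s c\<bar>) \<longlongrightarrow> 0) (at c)"
    using cont unfolding isCont_def by (auto intro!: tendsto_eq_intros)
  moreover have "\<forall>\<^sub>F y in at c. norm ((f y - f c) / (y - c) - s c) \<le> \<bar>s y - s c\<bar>"
    unfolding eventually_at_filter using le by (intro always_eventually) blast
  ultimately have "((\<lambda>y. (f y - f c) / (y - c) - s c) \<longlongrightarrow> 0) (at c)"
    by (rule Lim_null_comparison[rotated])
  then show ?thesis by (simp add: has_field_derivative_iff LIM_zero_iff)
qed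

text \<open>Any supporting line minus \<open>f\<close> has a minimum at \<open>c\<close>, so its
  slope equals the derivative there.\<close>

lemma derivative_supergradient:
  assumes f: "concave_on UNIV f" and df: "(f has_real_derivative s) (at c)"
  shows "supergradient f c s"
proof -
  obtain t where t: "supergradient f c t" using ex_supergradient[OF f] by blast
  have "((\<lambda>y. f c + t * (y - c) - f y) has_real_derivative t - s) (at c)"
    by (auto intro!: derivative_eq_intros df)
  then have "t - s = 0"
    by (rule DERIV_local_min[of _ _ c 1]) (use t in \<open>auto simp: supergradient_def\<close>)
  with t show ?thesis by simp
qed

text \<open>If all slopes to the right of \<open>c\<close> were at most \<open>s c - e\<close>, then
  \<open>s c - e\<close> would itself be a supergradient at \<open>c\<close>, against
  uniqueness.\<close>

lemma right_limit_supergradient: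
  assumes s: "\<And>c. supergradient f c (s c)" and unique: "\<And>t. supergradient f c t \<Longrightarrow> t = s c"
    and "0 < e"
  shows "\<exists>y>c. s c - e < s y"
proof (rule ccontr)
  assume "\<not> ?thesis"
  then have le: "s y \<le> s c - e" if "c < y" for y using that by force
  have "f y \<le> f c + (s c - e) * (y - c)" for y
  proof (cases "c < y")
    case True
    show ?thesis
    proof (rule field_le_epsilon)
      fix r :: real assume r: "0 < r"
      \<comment> \<open>The slope bound holds only to the right of \<open>c\<close>, so the
        supergradient is taken at a point \<open>z\<close> so near to \<open>c\<close> that the
        error \<open>e * (z - c)\<close> is at most \<open>r\<close>.\<close>
      define z where "z = c + min (r / e) ((y - c) / 2)"
      have z: "c < z" "z < y" "e * (z - c) \<le> r"
        using True r \<open>0 < e\<close> by (auto simp: z_def min_def field_simps)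
      have "f y \<le> f z + s z * (y - z)" "f z \<le> f c + s c * (z - c)"
        using s by (auto simp: supergradient_def)
      moreover have "s z * (y - z) \<le> (s c - e) * (y - z)"
        using le z by (intro mult_right_mono) auto
      ultimately show "f y \<le> f c + (s c - e) * (y - c) + r"
        using z by (simp add: algebra_simps)
    qed
  next
    case False
    have "f y \<le> f c + s c * (y - c)" using s by (auto simp: supergradient_def)
    moreover have "e * (y - c) \<le> 0" using False \<open>0 < e\<close> by (simp add: mult_le_0_iff)
    ultimately show ?thesis by (simp add: algebra_simps)
  qed
  then have "s c - e = s c" by (intro unique) (auto simp: supergradient_def)
  with \<open>0 < e\<close> show False by simp
qed

text \<open>The function \<open>s\<close> is antitone, so only a jump could break continuity. The
  previous lemma excludes one on the right and, applied to the reflected function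
  \<open>\<lambda>x. f (- x)\<close>, one on the left.\<close>

lemma isCont_supergradient:
  assumes s: "\<And>c. supergradient f c (s c)" and unique: "\<And>t. supergradient f c t \<Longrightarrow> t = s c"
  shows "isCont s c"
proof -
  have refl: "supergradient (\<lambda>x. f (- x)) x (- t) \<longleftrightarrow> supergradient f (- x) t" for x t
  proof
    assume *: "supergradient (\<lambda>x. f (- x)) x (- t)"
    have "f y \<le> f (- x) + t * (y - (- x))" for y
      using *[unfolded supergradient_def, rule_format, of "- y"] by (simp add: algebra_simps)
    then show "supergradient f (- x) t" by (simp add: supergradient_def)
  next
    assume *: "supergradient f (- x) t"
    have "f (- y) \<le> f (- x) + (- t) * (y - x)" for y
      using *[unfolded supergradient_def, rule_format, of "- y"] by (simp add: algebra_simps)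
    then show "supergradient (\<lambda>x. f (- x)) x (- t)" by (simp add: supergradient_def)
  qed
  show ?thesis
    unfolding continuous_at_eps_delta
  proof (intro allI impI)
    fix e :: real assume e: "0 < e"
    obtain y where y: "c < y" "s c - e < s y"
      using right_limit_supergradient[of f s c, OF s unique e] by blast
    obtain z where z: "- c < z" "- s (- (- c)) - e < - s (- z)"
    proof -
      have "t = - s (- (- c))" if "supergradient (\<lambda>x. f (- x)) (- c) t" for t
        using unique[of "- t"] refl[of "- c" "- t"] that by simp
      then show ?thesis
        using right_limit_supergradient[of "\<lambda>x. f (- x)" "\<lambda>x. - s (- x)" "- c" e] s e refl that by blast
    qed
    have anti: "s b \<le> s a" if "a \<le> b" for a b
      using supergradient_antimono[OF s s, of a b] that by (cases "a = b") auto
    have "dist (s x) (s c) < e" if "dist x c < min (y - c) (c + z)" for x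
    proof -
      have "s y \<le> s x" "s x \<le> s (- z)" using that by (intro anti; auto simp: dist_real_def)+
      then show ?thesis using y z by (auto simp: dist_real_def)
    qed
    then show "\<exists>d>0. \<forall>x. dist x c < d \<longrightarrow> dist (s x) (s c) < e"
      using y z by (intro exI[of _ "min (y - c) (c + z)"]) auto
  qed
qed

text \<open>An open half-plane inside a closed one through the same origin has a parallel normal.
  The test directions lie on the boundary of the open half-plane, \<open>(- R, S)\<close> and
  \<open>(R, - S)\<close>, pushed inwards by \<open>e / r\<close> in the second coordinate.\<close>

lemma halfplane_parallel:
  fixes s r S R :: real
  assumes *: "\<And>a b. 0 < S * a + R * b \<Longrightarrow> 0 \<le> s * a + r * b" and "0 < R" "0 < r"
  shows "s * R = r * S"
proof (rule antisym)
  show "s * R \<le> r * S"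
  proof (rule field_le_epsilon)
    fix e :: real assume "0 < e"
    with assms *[of "- R" "S + e / r"] show "s * R \<le> r * S + e" by (simp add: algebra_simps)
  qed
  show "r * S \<le> s * R"
  proof (rule field_le_epsilon)
    fix e :: real assume "0 < e"
    with assms *[of R "- S + e / r"] show "r * S \<le> s * R + e" by (simp add: algebra_simps)
  qed
qed

section \<open>Two summands with diagonal-invariant directions\<close>

locale separable_pair =
  fixes f g :: "real \<Rightarrow> real"
  assumes mono_f: "strict_mono f" and mono_g: "strict_mono g"
    and cont_f: "continuous_on UNIV f" and cont_g: "continuous_on UNIV g"
    and quasiconcave: "v \<le> f x + g y \<Longrightarrow> v \<le> f x' + g y' \<Longrightarrow> 0 \<le> t \<Longrightarrow> t \<le> 1 \<Longrightarrow>
      v \<le> f (t * x + (1 - t) * x') + g (t * y + (1 - t) * y')"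
    and direction: "0 < \<alpha> \<Longrightarrow> f c + g c \<le> f (c + \<alpha> * a) + g (c + \<alpha> * b) \<Longrightarrow>
      \<exists>\<beta>>0. f c' + g c' \<le> f (c' + \<beta> * a) + g (c' + \<beta> * b)"
begin

lemma direction_shorter:
  assumes "f c + g c \<le> f (c + \<beta> * a) + g (c + \<beta> * b)" "0 \<le> h" "h \<le> \<beta>" "0 < \<beta>"
  shows "f c + g c \<le> f (c + h * a) + g (c + h * b)"
proof -
  have "h / \<beta> * (c + \<beta> * x) + (1 - h / \<beta>) * c = c + h * x" for x
    using assms by (simp add: field_simps)
  then show ?thesis
    using quasiconcave[of "f c + g c" "c + \<beta> * a" "c + \<beta> * b" c c "h / \<beta>"] assms by simp
qed

text \<open>If both fail to be concave, there are points \<open>p\<close> and \<open>q\<close> near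
  which \<open>f\<close> and \<open>g\<close> lie above lines of slopes \<open>k\<close> and
  \<open>l\<close>. The steps \<open>m / k\<close> and \<open>m / l\<close> trade off equally along
  these lines, so both opposite trades strictly improve on \<open>(p, q)\<close>. But
  \<open>(p, q)\<close> is their midpoint, which contradicts quasiconcavity.\<close>

lemma one_concave: "concave_on UNIV f \<or> concave_on UNIV g"
proof (rule ccontr)
  assume "\<not> ?thesis"
  then have nc: "\<not> concave_on UNIV f" "\<not> concave_on UNIV g" by auto
  obtain p k e where p: "0 < k" "0 < e"
    "\<forall>h. 0 < h \<longrightarrow> h < e \<longrightarrow> f p + k * h < f (p + h) \<and> f p - k * h \<le> f (p - h)"
    using not_concave_point[OF cont_f mono_f nc(1)] by blast
  obtain q l d where q: "0 < l" "0 < d"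
    "\<forall>h. 0 < h \<longrightarrow> h < d \<longrightarrow> g q + l * h < g (q + h) \<and> g q - l * h \<le> g (q - h)"
    using not_concave_point[OF cont_g mono_g nc(2)] by blast
  \<comment> \<open>The factor 1/2 makes \<open>m / k\<close> and \<open>m / l\<close> smaller than
    the radii \<open>e\<close> and \<open>d\<close>.\<close>
  define m where "m = min (e * k) (d * l) / 2"
  have "0 < e * k" "0 < d * l" using p(1,2) q(1,2) by simp_all
  then have "0 < m" "m < e * k" "m < d * l" unfolding m_def by linarith+
  then have m: "0 < m / k" "m / k < e" "0 < m / l" "m / l < d"
    using p(1) q(1) by (simp_all add: pos_divide_less_eq)
  have "f p + g q < f (p + m / k) + g (q - m / l)" "f p + g q < f (p - m / k) + g (q + m / l)"
    using p(3)[rule_format, OF m(1,2)] q(3)[rule_format, OF m(3,4)] p(1) q(1) by auto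
  then obtain v where "f p + g q < v" "v \<le> f (p + m / k) + g (q - m / l)" "v \<le> f (p - m / k) + g (q + m / l)"
    by (metis linorder_le_cases order_refl)
  then show False
    using quasiconcave[of v "p + m / k" "q - m / l" "p - m / k" "q + m / l" "1 / 2"] by (simp add: field_simps)
qed

text \<open>At a common continuity point \<open>c0\<close> of two supergradient selections, an open
  half-plane of directions improves. Transported to any \<open>c\<close>, it fixes the ratio of
  every supergradient of \<open>f\<close> to every supergradient of \<open>g\<close>. Hence
  supergradients are unique, both functions are differentiable, and \<open>g - ?k * f\<close> has
  derivative zero.\<close>

lemma concave_imp_proportional:
  assumes f: "concave_on UNIV f" and g: "concave_on UNIV g"
  shows "\<exists>s k m. 0 < k \<and> (\<forall>c. (f has_real_derivative s c) (at c)) \<and> (\<forall>x. g x = k * f x + m)"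
proof -
  obtain s where s: "\<And>c. supergradient f c (s c)" using ex_supergradient[OF f] by metis
  obtain r where r: "\<And>c. supergradient g c (r c)" using ex_supergradient[OF g] by metis
  have pos: "0 < s c" "0 < r c" for c 
    by (rule supergradient_pos[OF mono_f s], rule supergradient_pos[OF mono_g r])
  \<comment> \<open>Supergradients are antitone, and a monotone function has at most countably many
    discontinuities.\<close>
  have disc: "countable {c. \<not> isCont h c}" if "\<And>c. supergradient F c (h c)" for F h :: "real \<Rightarrow> real"
  proof -
    have "mono (\<lambda>c. - h c)"
      using supergradient_antimono[OF that that] by (intro monoI) (metis neg_le_iff_le order_le_less)
    then have "countable {c. \<not> isCont (\<lambda>c. - h c) c}" by (rule mono_ctble_discont)
    moreover have "isCont (\<lambda>c. - h c) c \<Longrightarrow> isCont h c" for c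
      using isCont_minus[of c "\<lambda>c. - h c"] by simp
    ultimately show ?thesis by (elim countable_subset[rotated]) auto
  qed
  have "countable ({c. \<not> isCont s c} \<union> {c. \<not> isCont r c})"
    using disc[OF s] disc[OF r] by simp
  then have "{c. \<not> isCont s c} \<union> {c. \<not> isCont r c} \<noteq> UNIV" using uncountable_UNIV_real by metis
  then obtain c0 where c0: "isCont s c0" "isCont r c0" by blast
  \<comment> \<open>Supergradients at the end of the step, rather than at \<open>c0\<close>, bound
    the gain from below by \<open>h * ?F h\<close>; continuity at \<open>c0\<close> keeps
    \<open>?F h\<close> positive for small \<open>h\<close>.\<close>
  have half: "\<exists>\<alpha>>0. f c0 + g c0 \<le> f (c0 + \<alpha> * a) + g (c0 + \<alpha> * b)"
    if "0 < s c0 * a + r c0 * b" for a b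
  proof -
    let ?F = "\<lambda>h. s (c0 + h * a) * a + r (c0 + h * b) * b"
    have "isCont (\<lambda>h. s (c0 + h * a)) 0" "isCont (\<lambda>h. r (c0 + h * b)) 0"
      using isCont_o2[of 0 "\<lambda>h. c0 + h * a" s] isCont_o2[of 0 "\<lambda>h. c0 + h * b" r] c0 by simp_all
    then have "isCont ?F 0" by (intro continuous_intros)
    then have "(?F \<longlongrightarrow> ?F 0) (at_right 0)"
      unfolding isCont_def by (rule filterlim_mono) (auto simp: at_le)
    then have "eventually (\<lambda>h. 0 < ?F h) (at_right 0)"
      using that by (intro order_tendstoD(1)[of ?F "?F 0"]) auto
    then have "eventually (\<lambda>h. 0 < ?F h \<and> 0 < h) (at_right 0)"
      using eventually_at_right_less by (rule eventually_conj)
    then obtain h where h: "0 < ?F h" "0 < h"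
      by (metis (mono_tags, lifting) eventually_happens trivial_limit_at_right_real)
    have "f c0 \<le> f (c0 + h * a) + s (c0 + h * a) * (c0 - (c0 + h * a))"
         "g c0 \<le> g (c0 + h * b) + r (c0 + h * b) * (c0 - (c0 + h * b))"
      using s r unfolding supergradient_def by blast+
    then have "f c0 + g c0 + h * ?F h \<le> f (c0 + h * a) + g (c0 + h * b)" by (simp add: algebra_simps)
    moreover have "0 < h * ?F h" using h by simp
    ultimately show ?thesis using h by (intro exI[of _ h]) linarith
  qed
  have ratio: "\<sigma> * r c0 = \<rho> * s c0" if sg: "supergradient f c \<sigma>" "supergradient g c \<rho>" for c \<sigma> \<rho>
  proof (rule halfplane_parallel)
    fix a b assume "0 < s c0 * a + r c0 * b"
    then obtain \<beta> where \<beta>: "\<beta> > 0" "f c + g c \<le> f (c + \<beta> * a) + g (c + \<beta> * b)"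
      using half direction by blast
    have "f (c + \<beta> * a) \<le> f c + \<sigma> * (\<beta> * a)" "g (c + \<beta> * b) \<le> g c + \<rho> * (\<beta> * b)"
      using sg unfolding supergradient_def by (metis add_diff_cancel_left')+
    with \<beta> have "0 \<le> \<beta> * (\<sigma> * a + \<rho> * b)" by (simp add: algebra_simps)
    with \<beta> show "0 \<le> \<sigma> * a + \<rho> * b" by (simp add: zero_le_mult_iff)
  qed (use pos supergradient_pos[OF mono_g sg(2)] in auto)
  \<comment> \<open>\<open>ratio\<close> holds for arbitrary supergradients, so with the one of
    \<open>g\<close> kept fixed it determines the one of \<open>f\<close>.\<close>
  have uf: "t = s c" if "supergradient f c t" for c t
  proof -
    have "t * r c0 = s c * r c0" using ratio[OF that r] ratio[OF s r, of c] by simp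
    then show ?thesis using pos(2)[of c0] by simp
  qed
  have ug: "t = r c" if "supergradient g c t" for c t
  proof -
    have "t * s c0 = r c * s c0" using ratio[OF s that] ratio[OF s r, of c] by metis
    then show ?thesis using pos(1)[of c0] by simp
  qed
  have df: "(f has_real_derivative s c) (at c)" for c
    using s by (intro has_derivative_supergradient isCont_supergradient uf)
  have dg: "(g has_real_derivative r c) (at c)" for c
    using r by (intro has_derivative_supergradient isCont_supergradient ug)
  let ?k = "r c0 / s c0"
  have "((\<lambda>x. g x - ?k * f x) has_real_derivative 0) (at c)" for c
  proof -
    have "r c - ?k * s c = 0" using ratio[OF s r, of c] pos[of c0] by (simp add: field_simps)
    then show ?thesis using DERIV_diff[OF dg DERIV_cmult[OF df, of ?k], of c] by simp
  qed
  then have "g x - ?k * f x = g 0 - ?k * f 0" for x by (intro DERIV_isconst_all) auto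
  then have "g x = ?k * f x + (g 0 - ?k * f 0)" for x by (simp add: algebra_simps)
  moreover have "0 < ?k" using pos by simp
  ultimately show ?thesis using df by blast
qed

text \<open>If \<open>g\<close> is not concave, it lies above a line of slope \<open>k\<close> near
  some \<open>p\<close>, so all directions with \<open>q * a + k * b > 0\<close> improve at
  \<open>p\<close>, hence at every diagonal point. Directions close to the boundary of this
  half-plane bound the one-sided Dini derivatives of \<open>G = g - k / q * f\<close> from both
  sides by 0. So \<open>G\<close> is constant and \<open>g\<close> is concave after all.\<close>

lemma concave_if_other_differentiable:
  assumes df: "\<And>c. (f has_real_derivative s c) (at c)" and s: "\<And>c. 0 < s c"
    and f: "concave_on UNIV f"
  shows "concave_on UNIV g"
proof (rule ccontr)
  assume nc: "\<not> concave_on UNIV g"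
  obtain p k e where p: "0 < k" "0 < e"
    "\<forall>h. 0 < h \<longrightarrow> h < e \<longrightarrow> g p + k * h < g (p + h) \<and> g p - k * h \<le> g (p - h)"
    using not_concave_point[OF cont_g mono_g nc] by blast
  define q where "q = s p"
  have q: "0 < q" using s by (simp add: q_def)
  have lower: "g p + k * h \<le> g (p + h)" if "\<bar>h\<bar> < e" for h
    using p(3)[rule_format, of h] p(3)[rule_format, of "- h"] that by (cases h "0 :: real" rule: linorder_cases) auto
  have df': "((\<lambda>h. f (c + h * a)) has_real_derivative s c * a) (at 0)" for c a
    by (rule DERIV_chain2[where f = f and g = "\<lambda>h. c + h * a"]) (auto intro!: df derivative_eq_intros)
  have dir: "\<exists>\<beta>>0. f c + g c \<le> f (c + \<beta> * a) + g (c + \<beta> * b)" if ab: "0 < q * a + k * b" for a b c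
  proof -
    have "((\<lambda>h. f (p + h * a) + k * b * h) has_real_derivative q * a + k * b) (at 0)"
      unfolding q_def by (auto intro!: derivative_eq_intros df')
    from DERIV_pos_inc_right[OF this ab]
    obtain d where d: "d > 0" "\<And>h. 0 < h \<Longrightarrow> h < d \<Longrightarrow> f p < f (p + h * a) + k * b * h" by auto
    \<comment> \<open>The second bound keeps \<open>h * b\<close> within the radius \<open>e\<close>
      of the lower line; adding 1 covers \<open>b = 0\<close>.\<close>
    define h where "h = min (d / 2) (e / (\<bar>b\<bar> + 1))"
    have h: "0 < h" "h < d" using d p by (auto simp: h_def)
    have "\<bar>h * b\<bar> < e"
    proof -
      have "h * \<bar>b\<bar> < h * (\<bar>b\<bar> + 1)" using h by simp
      also have "\<dots> \<le> e / (\<bar>b\<bar> + 1) * (\<bar>b\<bar> + 1)" by (intro mult_right_mono) (auto simp: h_def)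
      also have "\<dots> = e" by (simp add: field_simps)
      finally show ?thesis using h by (simp add: abs_mult)
    qed
    then have "g p + k * (h * b) \<le> g (p + h * b)" by (rule lower)
    with d(2)[OF h] have "f p + g p \<le> f (p + h * a) + g (p + h * b)" by (simp add: algebra_simps)
    then show ?thesis using direction h by blast
  qed
  define G where "G x = g x - k / q * f x" for x
  have main: "\<exists>d>0. \<forall>h. 0 < h \<longrightarrow> h < d \<longrightarrow> G c - e * h \<le> G (c + h * \<sigma>)"
    if e: "0 < e" and \<sigma>: "\<bar>\<sigma>\<bar> = 1" for c e \<sigma>
  proof -
    \<comment> \<open>The direction \<open>(a, \<sigma>)\<close> is the boundary direction moved
      inwards by \<open>\<eta>\<close>. The move costs \<open>s c * \<eta> = e / 2\<close> to first
      order, half of the allowed slack, so \<open>?\<phi>\<close> has derivative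
      \<open>e / 2\<close> at 0.\<close>
    define \<eta> where "\<eta> = e / (2 * s c)"
    define a where "a = \<eta> - k / q * \<sigma>"
    have \<eta>: "0 < \<eta>" "s c * \<eta> = e / 2" using e s[of c] by (auto simp: \<eta>_def)
    have "q * a + k * \<sigma> = q * \<eta>" using q by (simp add: a_def field_simps)
    then obtain \<beta> where \<beta>: "\<beta> > 0" "f c + g c \<le> f (c + \<beta> * a) + g (c + \<beta> * \<sigma>)"
      using dir[of a \<sigma> c] mult_pos_pos[OF q \<eta>(1)] by auto
    let ?\<phi> = "\<lambda>h. f c - f (c + h * a) - k / q * (f (c + h * \<sigma>) - f c) + e * h"
    have "(?\<phi> has_real_derivative (- (s c * a) - k / q * (s c * \<sigma>) + e)) (at 0)"
      using q by (auto intro!: derivative_eq_intros df')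
    moreover have "- (s c * a) - k / q * (s c * \<sigma>) + e = e / 2"
      using \<eta> by (simp add: a_def algebra_simps)
    ultimately have "(?\<phi> has_real_derivative e / 2) (at 0)" by (simp only:)
    from DERIV_pos_inc_right[OF this] e
    obtain d where d: "d > 0" "\<And>h. 0 < h \<Longrightarrow> h < d \<Longrightarrow> ?\<phi> 0 < ?\<phi> h" by auto
    have "G c - e * h \<le> G (c + h * \<sigma>)" if h: "0 < h" "h < min d \<beta>" for h
    proof -
      have "f c + g c \<le> f (c + h * a) + g (c + h * \<sigma>)"
        using direction_shorter[OF \<beta>(2)] h \<beta>(1) by simp
      moreover have "0 < ?\<phi> h" using d(2)[of h] h by simp
      ultimately show ?thesis by (simp add: G_def algebra_simps)
    qed
    then show ?thesis using d(1) \<beta>(1) by (intro exI[of _ "min d \<beta>"]) auto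
  qed
  have contG: "continuous_on UNIV G"
    unfolding G_def by (intro continuous_intros cont_f cont_g)
  have up: "G x \<le> G y" if "x \<le> y" for x y
    using main[of _ 1] that by (intro nondecreasing_if_right_lower_derivative_nonneg[OF contG]) auto
  \<comment> \<open>The case \<open>\<sigma> = - 1\<close> of \<open>main\<close> is the right-hand
    condition for the reflected function.\<close>
  have down: "G y \<le> G x" if "x \<le> y" for x y
  proof -
    have "G (- (- y)) \<le> G (- (- x))"
    proof (rule nondecreasing_if_right_lower_derivative_nonneg[of "\<lambda>x. G (- x)"])
      show "continuous_on UNIV (\<lambda>x. G (- x))"
        by (intro continuous_on_compose2[OF contG] continuous_intros) auto
      show "\<exists>d>0. \<forall>h. 0 < h \<longrightarrow> h < d \<longrightarrow> G (- c) - e * h \<le> G (- (c + h))" if "0 < e" for c e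
        using main[OF that, of "- 1" "- c"] by simp
    qed (use that in auto)
    then show ?thesis by simp
  qed
  have "G x = G 0" for x using up down by (metis antisym linear)
  then have "g = (\<lambda>x. k / q * f x + G 0)" by (auto simp: G_def fun_eq_iff algebra_simps)
  moreover have "concave_on UNIV (\<lambda>x. k / q * f x + G 0)"
    using p q f by (intro concave_on_add concave_on_cmul) (auto simp: concave_on_const)
  ultimately show False using nc by simp
qed

end

text \<open>A direction in which the sum is locally constant at one diagonal point stays weakly
  improving at every other one; between the tangent and the graph there is then no room left.\<close>

lemma (in separable_pair) strictly_concave_or_affine:
  assumes df: "\<And>c. (f has_real_derivative s c) (at c)" and f: "concave_on UNIV f"
    and g: "\<And>x. g x = k * f x + m" "0 < k"
  shows "strictly_concave f \<or> (\<exists>A B. \<forall>x. f x = A * x + B)"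
proof (rule disjCI)
  assume naff: "\<nexists>A B. \<forall>x. f x = A * x + B"
  have sg: "f y \<le> f c + s c * (y - c)" for c y
    using derivative_supergradient[OF f df] by (auto simp: supergradient_def)
  \<comment> \<open>If \<open>f\<close> meets its tangent at both ends of an interval, concavity
    keeps it on the tangent in between.\<close>
  have chord: "f y = f c + s c * (y - c)"
    if eq: "f a = f c + s c * (a - c)" "f b = f c + s c * (b - c)" and y: "a \<le> y" "y \<le> b" and "a < b"
    for a b c y
  proof (rule antisym[OF sg])
    define t where "t = (y - a) / (b - a)"
    have "t * (b - a) = y - a" using \<open>a < b\<close> by (simp add: t_def)
    then have t: "y = (1 - t) * a + t * b" "0 \<le> t" "t \<le> 1"
      using y \<open>a < b\<close> by (simp add: algebra_simps, simp_all add: t_def divide_le_eq)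
    have "(1 - t) * f a + t * f b \<le> f y"
      unfolding t(1) using concave_onD[OF f, of t a b] t by simp
    moreover have "(1 - t) * f a + t * f b = f c + s c * (y - c)"
      unfolding eq t(1) by (simp add: algebra_simps)
    ultimately show "f c + s c * (y - c) \<le> f y" by simp
  qed
  show "strictly_concave f"
  proof (rule ccontr)
    assume "\<not> strictly_concave f"
    then obtain a b t where t: "0 < t" "t < 1" "a \<noteq> b" "f (t * a + (1 - t) * b) \<le> t * f a + (1 - t) * f b"
      by (auto simp: strictly_concave_def not_less)
    \<comment> \<open>At this mixture concavity is not strict. The deviations of \<open>f a\<close>
      and \<open>f b\<close> from the tangent at \<open>c\<close> are nonpositive with a nonnegative
      weighted sum, so both vanish.\<close>
    define c where "c = t * a + (1 - t) * b"
    have lin: "t * (f a - (f c + s c * (a - c))) + (1 - t) * (f b - (f c + s c * (b - c))) \<ge> 0"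
      using t(4) unfolding c_def[symmetric] by (simp add: c_def algebra_simps)
    have neg: "f a - (f c + s c * (a - c)) \<le> 0" "f b - (f c + s c * (b - c)) \<le> 0"
      using sg[of a c] sg[of b c] by auto
    have "t * (f a - (f c + s c * (a - c))) \<le> 0" "(1 - t) * (f b - (f c + s c * (b - c))) \<le> 0"
      using neg t by (auto simp: mult_le_0_iff)
    with lin have "t * (f a - (f c + s c * (a - c))) = 0" "(1 - t) * (f b - (f c + s c * (b - c))) = 0"
      by linarith+
    then have eq: "f a = f c + s c * (a - c)" "f b = f c + s c * (b - c)" using t by auto
    define l where "l = min a b" define u where "u = max a b"
    have lu: "l < u" "f l = f c + s c * (l - c)" "f u = f c + s c * (u - c)"
      using eq t(3) by (auto simp: l_def u_def min_def max_def)
    have c: "l < c" "c < u"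
    proof -
      have "c = a + (1 - t) * (b - a)" "c = b + t * (a - b)" by (auto simp: c_def algebra_simps)
      then show "l < c" "c < u" using t
        by (smt (verit) l_def u_def min_def max_def mult_pos_pos mult_pos_neg)+
    qed
    \<comment> \<open>Dividing by \<open>1 + k\<close> keeps both \<open>c + h * k\<close> and
      \<open>c - h\<close> inside the segment where \<open>f\<close> is affine. Since
      \<open>g\<close> is \<open>k\<close> times \<open>f\<close> up to a constant, the direction
      \<open>(k, - 1)\<close> then leaves the sum unchanged.\<close>
    define h where "h = min (u - c) (c - l) / (1 + k)"
    have h: "0 < h" "h * k \<le> u - c" "h \<le> c - l"
    proof -
      show "0 < h" using c g(2) by (auto simp: h_def)
      have "h * (1 + k) \<le> u - c" "h * (1 + k) \<le> c - l" using g(2) by (auto simp: h_def)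
      moreover have "0 < h * k" using \<open>0 < h\<close> g(2) by simp
      ultimately show "h * k \<le> u - c" "h \<le> c - l"
        using \<open>0 < h\<close> by (auto simp: algebra_simps)
    qed
    have "0 < h * k" using h(1) g(2) by simp
    then have "f (c + h * k) = f c + s c * (h * k)" "f (c + h * (- 1)) = f c - s c * h"
      using chord[OF lu(2,3) _ _ lu(1), of "c + h * k"] chord[OF lu(2,3) _ _ lu(1), of "c - h"] h c by auto
    then have start: "f c + g c \<le> f (c + h * k) + g (c + h * (- 1))"
      unfolding g by (simp only:) (simp add: algebra_simps)
    \<comment> \<open>At \<open>x\<close> the tangent bounds say that the direction
      \<open>(k, - 1)\<close> cannot gain, while transport says that it does not lose. Equality puts
      \<open>f\<close> on its tangent around \<open>x\<close>, so its derivative is locally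
      constant.\<close>
    have ds: "(s has_real_derivative 0) (at x)" for x
    proof -
      obtain \<beta> where \<beta>: "\<beta> > 0" "f x + g x \<le> f (x + \<beta> * k) + g (x + \<beta> * (- 1))"
        using direction[OF h(1) start] by blast
      have "f (x + \<beta> * k) \<le> f x + s x * (\<beta> * k)" "f (x - \<beta>) \<le> f x - s x * \<beta>"
        using sg[of "x + \<beta> * k" x] sg[of "x - \<beta>" x] by auto
      moreover have "f x - f (x - \<beta>) \<le> (f (x + \<beta> * k) - f x) / k"
        using \<beta> g by (simp add: field_simps)
      moreover have "f (x + \<beta> * k) - f x \<le> k * (s x * \<beta>)" using calculation by (simp add: mult_ac)
      then have "(f (x + \<beta> * k) - f x) / k \<le> s x * \<beta>" using g(2) by (simp add: field_simps)
      ultimately have "f (x - \<beta>) = f x - s x * \<beta>" and "(f (x + \<beta> * k) - f x) / k = s x * \<beta>"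
        by linarith+
      then have eqs: "f (x - \<beta>) = f x + s x * ((x - \<beta>) - x)" "f (x + \<beta> * k) = f x + s x * ((x + \<beta> * k) - x)"
        using g(2) by (auto simp: field_simps)
      let ?N = "{x - \<beta> <..< x + \<beta> * k}"
      have "0 < \<beta> * k" using \<beta> g(2) by simp
      then have loc: "f y = f x + s x * (y - x)" if "y \<in> ?N" for y
        using chord[OF eqs, of y] \<beta>(1) that by auto
      have "s y = s x" if "y \<in> ?N" for y
      proof -
        have "((\<lambda>y. f x + s x * (y - x)) has_real_derivative s x) (at y)"
          by (auto intro!: derivative_eq_intros)
        then have "(f has_real_derivative s x) (at y)"
          by (rule has_field_derivative_transform_within_open[of _ _ _ ?N]) (use that loc in auto)
        with df show ?thesis by (rule DERIV_unique)
      qed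
      then have const: "s x = s y" if "y \<in> ?N" for y using that by metis
      have "x \<in> ?N" using \<beta>(1) \<open>0 < \<beta> * k\<close> by simp
      from const show ?thesis
        by (rule has_field_derivative_transform_within_open
            [OF DERIV_const open_greaterThanLessThan \<open>x \<in> ?N\<close>])
    qed
    have "s x = s 0" for x using ds by (rule DERIV_isconst_all[rule_format])
    then have "((\<lambda>x. f x - s 0 * x) has_real_derivative 0) (at x)" for x
      using df[of x] by (auto intro!: derivative_eq_intros)
    then have "f x - s 0 * x = f 0 - s 0 * 0" for x by (intro DERIV_isconst_all) auto
    then have "f x = s 0 * x + f 0" for x by (metis diff_zero mult_zero_right eq_diff_eq add.commute)
    with naff show False by blast
  qed
qed

section \<open>Additive representation of separable preferences\<close>

text \<open>Continuity is stated along lines and separability one coordinate at a time.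
  \<open>mono\<close> compares only coordinates in \<open>I\<close>, so values outside
  \<open>I\<close> do not affect the preference.\<close>

locale separable_preference =
  fixes I :: "'i set" and P :: "('i \<Rightarrow> real) \<Rightarrow> ('i \<Rightarrow> real) \<Rightarrow> bool"
  assumes finite_index: "finite I"
    and card_index: "3 \<le> card I"
    and total: "P X Y \<or> P Y X"
    and trans: "P X Y \<Longrightarrow> P Y Z \<Longrightarrow> P X Z"
    and mono: "(\<And>i. i \<in> I \<Longrightarrow> Y i \<le> X i) \<Longrightarrow> P X Y"
    and strict: "(\<And>i. i \<in> I \<Longrightarrow> Y i \<le> X i) \<Longrightarrow> i \<in> I \<Longrightarrow> Y i < X i \<Longrightarrow> \<not> P Y X"
    and closed_upper: "closed {t. P (\<lambda>i. X i + t * V i) Y}"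
    and closed_lower: "closed {t. P Y (\<lambda>i. X i + t * V i)}"
    and convex: "P X Y \<Longrightarrow> P Y X \<Longrightarrow> 0 \<le> a \<Longrightarrow> a \<le> 1 \<Longrightarrow>
      P (\<lambda>i. a * X i + (1 - a) * Y i) X"
    and separable: "k \<in> I \<Longrightarrow> X k = Y k \<Longrightarrow> P (X(k := t)) (Y(k := t)) \<longleftrightarrow> P X Y"
begin

definition ind :: "('i \<Rightarrow> real) \<Rightarrow> ('i \<Rightarrow> real) \<Rightarrow> bool" where
  "ind X Y \<longleftrightarrow> P X Y \<and> P Y X"

lemma ind_sym: "ind X Y \<Longrightarrow> ind Y X"
  and ind_trans: "ind X Y \<Longrightarrow> ind Y Z \<Longrightarrow> ind X Z"
  using trans by (auto simp: ind_def)

lemma ind_refl: "ind X X"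
  using total[of X X] by (simp add: ind_def)

lemma ind_cong: "(\<And>i. i \<in> I \<Longrightarrow> X i = Y i) \<Longrightarrow> ind X Y"
  by (auto simp: ind_def intro: mono)

lemma ind_upd: "k \<in> I \<Longrightarrow> X k = Y k \<Longrightarrow> ind (X(k := t)) (Y(k := t)) \<longleftrightarrow> ind X Y"
  by (simp add: ind_def separable)

text \<open>The interval from 0 to \<open>T\<close> is connected and covered by two closed sets, one
  containing 0 and the other \<open>T\<close>; a common point is an indifference.\<close>

lemma crossing:
  assumes "P X Y" "P Y (\<lambda>i. X i + T * V i)" "0 \<le> T"
  shows "\<exists>t\<in>{0..T}. ind (\<lambda>i. X i + t * V i) Y"
proof (rule ccontr)
  assume neg: "\<not> ?thesis"
  let ?A = "{t. P (\<lambda>i. X i + t * V i) Y}" and ?B = "{t. P Y (\<lambda>i. X i + t * V i)}"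
  have "0 \<in> ?A" "T \<in> ?B" using assms by auto
  moreover have "{0..T} \<subseteq> ?A \<union> ?B" using total by auto
  moreover have "?A \<inter> ?B \<inter> {0..T} = {}" using neg by (auto simp: ind_def)
  moreover have "connected {0..T}" by (rule connected_Icc)
  ultimately show False
    using closed_upper[of X V Y] closed_lower[of Y X V] assms(3)
    unfolding connected_closed by (metis (no_types, lifting) Int_iff atLeastAtMost_iff empty_iff order_refl)
qed

text \<open>\<open>convex\<close> speaks of indifferent vectors only. So \<open>X\<close> is first
  lowered uniformly until it is indifferent to \<open>Y\<close>, and monotonicity compares the two
  mixtures. The sum \<open>T\<close> bounds every coordinate difference, so lowering by
  \<open>T\<close> suffices.\<close>

lemma quasiconcave:
  assumes "P X Y" "0 \<le> a" "a \<le> 1"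
  shows "P (\<lambda>i. a * X i + (1 - a) * Y i) Y"
proof -
  define T where "T = (\<Sum>i\<in>I. \<bar>X i - Y i\<bar>)"
  have T: "0 \<le> T" by (simp add: T_def sum_nonneg)
  have "\<bar>X i - Y i\<bar> \<le> T" if "i \<in> I" for i
    unfolding T_def using that finite_index by (intro member_le_sum) auto
  then have T': "P Y (\<lambda>i. X i + T * (- 1))" by (intro mono) force
  then obtain t where t: "0 \<le> t" "ind (\<lambda>i. X i + t * (- 1)) Y"
    using crossing[OF assms(1) T' T] by auto
  let ?Z = "\<lambda>i. X i + t * (- 1)"
  have "P (\<lambda>i. a * X i + (1 - a) * Y i) (\<lambda>i. a * ?Z i + (1 - a) * Y i)"
    using t assms by (intro mono) (auto intro!: mult_left_mono)
  moreover have "P (\<lambda>i. a * ?Z i + (1 - a) * Y i) ?Z"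
    using t assms by (intro convex) (auto simp: ind_def)
  ultimately show ?thesis using t trans unfolding ind_def by blast
qed

text \<open>If no loss in coordinate \<open>k\<close> outweighed the gain \<open>H\<close>, then by convexity
  \<open>- e\<^sub>k\<close> would be a direction of recession of the upper contour set at \<open>X\<close>.\<close>

lemma compensation:
  assumes H: "\<And>i. i \<in> I \<Longrightarrow> 0 \<le> H i" and k: "k \<in> I"
  shows "\<exists>t\<ge>0. P X ((\<lambda>i. X i + H i)(k := X k - t))"
proof (rule ccontr)
  assume neg: "\<not> ?thesis"
  define W where "W = X(k := X k - 1)"
  define V where "V = H(k := 0)"
  \<comment> \<open>Mixing with weight 1/(n+1) turns a loss of n+1 in coordinate \<open>k\<close>
    into a loss of 1, while the gain shrinks to \<open>H\<close> divided by n+1.\<close>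
  have n: "P (\<lambda>i. W i + inverse (real (Suc n)) * V i) X" for n
  proof -
    let ?a = "inverse (real (Suc n))"
    let ?Z = "(\<lambda>i. X i + H i)(k := X k - real (Suc n))"
    have "P ?Z X" using neg total by (meson of_nat_0_le_iff)
    then have 1: "P (\<lambda>i. ?a * ?Z i + (1 - ?a) * X i) X"
      by (rule quasiconcave) (auto simp: field_simps)
    have "?a * ?Z i + (1 - ?a) * X i = W i + ?a * V i" for i
    proof (cases "i = k")
      case True
      have "a * (x - m) + (1 - a) * x = x - a * m" for a x m :: real by (simp add: algebra_simps)
      moreover have "?a * real (Suc n) = 1" by (rule left_inverse) simp
      ultimately have "?a * (X k - real (Suc n)) + (1 - ?a) * X k = X k - 1" by metis
      then show ?thesis using True by (simp add: W_def V_def del: of_nat_Suc)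
    qed (simp add: W_def V_def distrib_left left_diff_distrib)
    with 1 show ?thesis by (simp only:)
  qed
  then have "0 \<in> {t. P (\<lambda>i. W i + t * V i) X}"
    using closed_sequentially[OF closed_upper[of W V X] _ LIMSEQ_inverse_real_of_nat] by blast
  then have "P W X" by simp
  moreover have "\<not> P W X" using k by (intro strict[where i = k]) (auto simp: W_def)
  ultimately show False by simp
qed

section \<open>Additive representation below a common bound\<close>

definition additive_below :: "real \<Rightarrow> ('i \<Rightarrow> real \<Rightarrow> real) \<Rightarrow> bool" where
  "additive_below c f \<longleftrightarrow> (\<forall>X Y. (\<forall>i\<in>I. X i \<le> c) \<longrightarrow> (\<forall>i\<in>I. Y i \<le> c) \<longrightarrow>
     (P X Y \<longleftrightarrow> (\<Sum>i\<in>I. f i (Y i)) \<le> (\<Sum>i\<in>I. f i (X i))))"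

end

text \<open>Here \<open>c\<close> is a common upper bound for the coordinates. Losses below \<open>c\<close> are measured
  by equivalent losses in coordinate \<open>p\<close>.\<close>

locale separable_preference_below = separable_preference I P
  for I :: "'i set" and P +
  fixes c :: real and p q r :: 'i
  assumes pqr: "p \<in> I" "q \<in> I" "r \<in> I" "p \<noteq> q" "p \<noteq> r" "q \<noteq> r"
begin

definition single :: "'i \<Rightarrow> real \<Rightarrow> 'i \<Rightarrow> real" where
  "single i l = (\<lambda>_. c)(i := c - l)"

text \<open>For \<open>X\<close> in \<open>below\<close> such a loss exists by compensation and is
  unique by strict monotonicity, so the choice is determined.\<close>

definition loss :: "'i \<Rightarrow> ('i \<Rightarrow> real) \<Rightarrow> real" where
  "loss i X = (SOME t. 0 \<le> t \<and> ind (single i t) X)"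

definition below :: "('i \<Rightarrow> real) set" where
  "below = {X. \<forall>i\<in>I. X i \<le> c}"

lemma single_simps [simp]: "single i l i = c - l" "j \<noteq> i \<Longrightarrow> single i l j = c" "single i 0 = (\<lambda>_. c)"
  by (auto simp: single_def)

lemma single_below [simp, intro]: "0 \<le> l \<Longrightarrow> single i l \<in> below"
  by (auto simp: single_def below_def)

lemma below_upd [simp, intro]: "X \<in> below \<Longrightarrow> 0 \<le> l \<Longrightarrow> X(k := c - l) \<in> below"
  by (auto simp: below_def)

lemma single_le_iff:
  assumes "i \<in> I"
  shows "P (single i s) (single i t) \<longleftrightarrow> s \<le> t"
proof
  show "s \<le> t" if "P (single i s) (single i t)"
    using that strict[of "single i s" "single i t" i] assms by (force simp: single_def)
qed (auto simp: single_def intro: mono)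

lemma
  assumes "X \<in> below" "i \<in> I"
  shows loss_nonneg: "0 \<le> loss i X" and ind_loss: "ind (single i (loss i X)) X"
proof -
  have X: "X j \<le> c" if "j \<in> I" for j using assms that by (auto simp: below_def)
  \<comment> \<open>Raising every other coordinate to \<open>c\<close> is compensated by some loss
    in coordinate \<open>i\<close>. This yields a loss \<open>?T\<close> from \<open>c\<close> that
    is no better than \<open>X\<close>, and \<open>crossing\<close> finds an equivalent one.\<close>
  obtain t where t: "0 \<le> t" "P X ((\<lambda>j. X j + (c - X j))(i := X i - t))"
    using compensation[of "\<lambda>j. c - X j" i X] X assms by auto
  let ?T = "c - X i + t" and ?V = "(\<lambda>_. 0)(i := - 1)"
  have s: "(\<lambda>j. c + s * ?V j) = single i s" for s by (auto simp: single_def fun_eq_iff)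
  have eq: "(\<lambda>j. X j + (c - X j))(i := X i - t) = single i ?T" by (auto simp: single_def)
  have "P X (\<lambda>j. c + ?T * ?V j)" using t(2) unfolding eq s .
  moreover have "P (\<lambda>_. c) X" using X by (intro mono)
  moreover have "0 \<le> ?T" using X assms t by simp
  ultimately have "\<exists>t. 0 \<le> t \<and> ind (single i t) X"
    using crossing[of "\<lambda>_. c" X ?T ?V] unfolding s by auto
  then have "0 \<le> loss i X \<and> ind (single i (loss i X)) X"
    unfolding loss_def by (rule someI_ex)
  then show "0 \<le> loss i X" "ind (single i (loss i X)) X" by auto
qed

lemma loss_le_iff:
  assumes "X \<in> below" "Y \<in> below" "i \<in> I"
  shows "P X Y \<longleftrightarrow> loss i X \<le> loss i Y"
  using ind_loss[OF assms(1,3)] ind_loss[OF assms(2,3)] single_le_iff[OF assms(3)] trans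
  unfolding ind_def by meson

lemma loss_eq: "X \<in> below \<Longrightarrow> Y \<in> below \<Longrightarrow> i \<in> I \<Longrightarrow> ind X Y \<Longrightarrow> loss i X = loss i Y"
  using loss_le_iff[of X Y i] loss_le_iff[of Y X i] by (auto simp: ind_def)

lemma loss_single [simp]: "i \<in> I \<Longrightarrow> 0 \<le> t \<Longrightarrow> loss i (single i t) = t"
  using ind_loss[of "single i t" i] single_le_iff[of i] by (force simp: ind_def)

text \<open>The aggregate of two losses in \<open>p\<close>. The second is moved to an equivalent
  loss in \<open>q\<close>, so that both can be suffered at once.\<close>

definition comb :: "real \<Rightarrow> real \<Rightarrow> real"  (infixl "\<diamondop>" 65) where
  "a \<diamondop> b = loss p ((single p a)(q := c - loss q (single p b)))"

text \<open>Separability in \<open>i\<close> replaces \<open>X\<close> by its equivalent loss in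
  \<open>p\<close>; separability in \<open>p\<close> then replaces the loss in \<open>i\<close> by
  the equivalent one in \<open>q\<close>. Thus every coordinate other than \<open>p\<close>
  aggregates by the same operation.\<close>

lemma loss_upd:
  assumes X: "X \<in> below" and i: "i \<in> I" "i \<noteq> p" "X i = c" and l: "0 \<le> l"
  shows "loss p (X(i := c - l)) = loss p X \<diamondop> loss p (single i l)"
proof -
  define a where "a = loss p X"
  define b where "b = loss p (single i l)"
  define h where "h = loss q (single p b)"
  have nn: "0 \<le> a" "0 \<le> b" "0 \<le> h" unfolding a_def b_def h_def
    using X l pqr i(1,2) loss_nonneg single_below by auto
  have "ind X (single p a)"
    unfolding a_def using X pqr by (intro ind_sym[OF ind_loss])
  then have 1: "ind (X(i := c - l)) ((single p a)(i := c - l))"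
    using i by (subst ind_upd) auto
  have "ind (single i l) (single p b)"
    unfolding b_def using l pqr i(1,2) by (intro ind_sym[OF ind_loss]) auto
  also have "ind (single p b) (single q h)"
    unfolding h_def using nn pqr by (intro ind_sym[OF ind_loss]) auto
  finally (ind_trans) have qh: "ind (single i l) (single q h)" .
  have "ind ((single p a)(i := c - l)) ((single p a)(q := c - h))"
  proof (cases "i = q")
    case True
    then have "l = h"
      using qh single_le_iff[of q] pqr by (auto simp: ind_def)
    then show ?thesis using True by (simp add: ind_refl)
  next
    case False
    have "ind ((single i l)(p := c - a)) ((single q h)(p := c - a))"
      using qh pqr i by (subst ind_upd) auto
    moreover have "(single i l)(p := c - a) = (single p a)(i := c - l)"
      "(single q h)(p := c - a) = (single p a)(q := c - h)"
      using i pqr by (auto simp: single_def)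
    ultimately show ?thesis by simp
  qed
  with 1 have "ind (X(i := c - l)) ((single p a)(q := c - h))" by (rule ind_trans)
  then show ?thesis
    unfolding comb_def a_def[symmetric] b_def[symmetric] h_def[symmetric]
    using X nn l pqr by (intro loss_eq) auto
qed

lemma ex_single: "i \<in> I \<Longrightarrow> 0 \<le> b \<Longrightarrow> \<exists>l\<ge>0. loss p (single i l) = b"
proof (intro exI conjI)
  assume a: "i \<in> I" "0 \<le> b"
  show nn: "0 \<le> loss i (single p b)" using a by (intro loss_nonneg) auto
  have "loss p (single i (loss i (single p b))) = loss p (single p b)"
    using a pqr nn by (intro loss_eq ind_loss) auto
  then show "loss p (single i (loss i (single p b))) = b" using a pqr by simp
qed

lemma comb_single:
  assumes "0 \<le> a" "0 \<le> l" "i \<in> I" "i \<noteq> p"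
  shows "a \<diamondop> loss p (single i l) = loss p ((single p a)(i := c - l))"
  using loss_upd[of "single p a" i l] assms pqr by auto

lemma comb_nonneg: "0 \<le> a \<Longrightarrow> 0 \<le> b \<Longrightarrow> 0 \<le> a \<diamondop> b"
  unfolding comb_def using pqr by (intro loss_nonneg below_upd) auto

text \<open>The third coordinate enters here: with \<open>a\<close> realised in \<open>r\<close> and
  \<open>b\<close> in \<open>q\<close>, the vector carrying both losses can be built in either
  order.\<close>

lemma comb_commute:
  assumes nn: "0 \<le> a" "0 \<le> b"
  shows "a \<diamondop> b = b \<diamondop> a"
proof -
  obtain l where l: "0 \<le> l" "loss p (single q l) = b" using ex_single pqr nn by metis
  obtain m where m: "0 \<le> m" "loss p (single r m) = a" using ex_single pqr nn by metis
  have "a \<diamondop> b = loss p ((single p a)(q := c - l))"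
    using comb_single[of a l q] l nn pqr by auto
  also have "ind (single p a) (single r m)"
    using ind_loss[of "single r m" p] m pqr by auto
  then have "loss p ((single p a)(q := c - l)) = loss p ((single r m)(q := c - l))"
    using pqr nn l m by (intro loss_eq below_upd) (auto simp: ind_upd)
  also have "(single r m)(q := c - l) = (single q l)(r := c - m)"
    using pqr by (auto simp: single_def)
  also have "loss p \<dots> = b \<diamondop> a"
    using loss_upd[of "single q l" r m] l m pqr by auto
  finally show "a \<diamondop> b = b \<diamondop> a" .
qed

lemma comb_right_commute:
  assumes nn: "0 \<le> a" "0 \<le> b" "0 \<le> d"
  shows "a \<diamondop> b \<diamondop> d = a \<diamondop> d \<diamondop> b"
proof -
  obtain l where l: "0 \<le> l" "loss p (single q l) = b" using ex_single pqr nn by metis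
  obtain m where m: "0 \<le> m" "loss p (single r m) = d" using ex_single pqr nn by metis
  have "loss p ((single p a)(q := c - l, r := c - m)) = a \<diamondop> b \<diamondop> d"
    using loss_upd[of "(single p a)(q := c - l)" r m] comb_single[of a l q] l m nn pqr
    by (auto simp: below_upd single_below)
  moreover have "loss p ((single p a)(r := c - m, q := c - l)) = a \<diamondop> d \<diamondop> b"
    using loss_upd[of "(single p a)(r := c - m)" q l] comb_single[of a m r] l m nn pqr
    by (auto simp: below_upd single_below)
  ultimately show ?thesis using fun_upd_twist[of q r] pqr by metis
qed

lemma loss_const [simp]: "loss p (\<lambda>_. c) = 0"
  using loss_single[of p 0] pqr by simp

text \<open>Starting from a loss of \<open>a\<close> in \<open>p\<close>, compensation supplies a
  further loss in \<open>q\<close> that makes the vector no better than a loss of \<open>b\<close>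
  in \<open>p\<close>; \<open>crossing\<close> yields indifference.\<close>

lemma comb_diff:
  assumes "0 \<le> a" "a \<le> b"
  shows "\<exists>d\<ge>0. b = a \<diamondop> d"
proof -
  have upd: "(\<lambda>i. single p a i + s * ((\<lambda>_. 0)(q := - 1)) i) = (single p a)(q := c - s)" for s
    using pqr by (auto simp: single_def fun_eq_iff)
  have "\<exists>t\<ge>0. P (single p b)
      ((\<lambda>i. single p b i + ((\<lambda>_. 0)(p := b - a)) i)(q := single p b q - t))"
    by (rule compensation) (use assms pqr in auto)
  then obtain t where t: "0 \<le> t"
    "P (single p b) ((\<lambda>i. single p b i + ((\<lambda>_. 0)(p := b - a)) i)(q := single p b q - t))"
    by blast
  note t(2)
  also have "(\<lambda>i. single p b i + ((\<lambda>_. 0)(p := b - a)) i)(q := single p b q - t)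
      = (single p a)(q := c - t)"
    using pqr by (auto simp: single_def fun_eq_iff)
  finally have "P (single p b) (\<lambda>i. single p a i + t * ((\<lambda>_. 0)(q := - 1)) i)"
    by (simp only: upd)
  moreover have "P (single p a) (single p b)" using assms pqr by (simp add: single_le_iff)
  ultimately obtain s where s: "0 \<le> s" "ind ((single p a)(q := c - s)) (single p b)"
    using crossing[of "single p a" "single p b" t "(\<lambda>_. 0)(q := - 1)"] t unfolding upd by auto
  have "loss p ((single p a)(q := c - s)) = loss p (single p b)"
    using s assms pqr by (intro loss_eq) auto
  then have "b = a \<diamondop> loss p (single q s)"
    using s assms pqr by (simp add: comb_single)
  then show ?thesis using s pqr by (intro exI[of _ "loss p (single q s)"]) (auto simp: loss_nonneg single_below)
qed

text \<open>If the multiples of \<open>a\<close> were bounded with supremum \<open>L\<close>,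
  closedness would make a loss of \<open>L\<close> in \<open>p\<close> together with
  \<open>l\<close> in \<open>q\<close> no worse than the loss of \<open>L\<close> alone, against
  strict monotonicity.\<close>

lemma comb_archimedean:
  assumes "0 < a"
  shows "\<exists>n. b \<le> ((\<lambda>x. x \<diamondop> a) ^^ n) 0"
proof (rule ccontr)
  assume neg: "\<not> ?thesis"
  define M where "M n = ((\<lambda>x. x \<diamondop> a) ^^ n) 0" for n
  have M: "M 0 = 0" "M (Suc n) = M n \<diamondop> a" for n by (simp_all add: M_def)
  have nn: "0 \<le> M n" for n by (induction n) (use assms in \<open>auto simp: M comb_nonneg\<close>)
  have bdd: "bdd_above (range M)"
    using neg by (intro bdd_aboveI[of _ b]) (auto simp: M_def not_le intro: less_imp_le)
  define L where "L = Sup (range M)"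
  have le_L: "M n \<le> L" for n unfolding L_def using bdd by (intro cSup_upper) auto
  with M have L: "0 \<le> L" by metis
  obtain l where l: "0 \<le> l" "loss p (single q l) = a" using ex_single[of q a] pqr assms by auto
  with assms have l0: "0 < l" by (cases "l = 0") auto
  have upd: "(\<lambda>i. ((\<lambda>_. c)(q := c - l)) i + s * ((\<lambda>_. 0)(p := - 1)) i) = (single p s)(q := c - l)" for s
    using pqr by (auto simp: single_def fun_eq_iff)
  let ?S = "{s. P ((single p s)(q := c - l)) (single p L)}"
  have "closed ?S"
    using closed_upper[of "(\<lambda>_. c)(q := c - l)" "(\<lambda>_. 0)(p := - 1)" "single p L"] unfolding upd .
  moreover have "M n \<in> ?S" for n
  proof -
    have "loss p ((single p (M n))(q := c - l)) = M (Suc n)"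
      using comb_single[of "M n" l q] l nn pqr by (simp add: M)
    then show ?thesis using loss_le_iff[of "(single p (M n))(q := c - l)" "single p L" p] le_L[of "Suc n"] L l nn pqr
      by auto
  qed
  ultimately have "L \<in> ?S" unfolding L_def using bdd by (intro closed_subset_contains_Sup) auto
  moreover have "\<not> P ((single p L)(q := c - l)) (single p L)"
    using l0 pqr by (intro strict[where i = q]) auto
  ultimately show False by simp
qed

sublocale archimedean_monoid "(\<diamondop>)"
proof
  fix a b d :: real
  assume nn: "0 \<le> a" "0 \<le> b" "0 \<le> d"
  \<comment> \<open>Associativity from two exchanges: (a b) d = (b a) d = (b d) a = a (b d).\<close>
  show "a \<diamondop> b \<diamondop> d = a \<diamondop> (b \<diamondop> d)"
    using nn comb_commute[of a b] comb_right_commute[of b a d] comb_commute[of "b \<diamondop> d" a] comb_nonneg[of b d]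
    by simp
next
  fix a :: real
  assume "0 \<le> a"
  moreover have "(single p a)(q := c) = single p a" using pqr by (auto simp: single_def)
  ultimately show "a \<diamondop> 0 = a"
    using comb_single[of a 0 q] pqr by simp
next
  fix a b d :: real
  assume ab: "0 \<le> a" "a < b" and d: "0 \<le> d"
  obtain l where l: "0 \<le> l" "loss p (single q l) = d" using ex_single pqr d by metis
  have "\<not> P ((single p b)(q := c - l)) ((single p a)(q := c - l))"
    using ab pqr by (subst separable) (auto simp: single_le_iff)
  then show "a \<diamondop> d < b \<diamondop> d"
    using comb_single[of a l q] comb_single[of b l q] ab l pqr
      loss_le_iff[of "(single p b)(q := c - l)" "(single p a)(q := c - l)" p]
    by auto
qed (use comb_nonneg comb_commute comb_diff comb_archimedean in auto)

definition score :: "'i \<Rightarrow> real \<Rightarrow> real" where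
  "score i x = - embed (loss p (single i (c - x)))"

text \<open>Start with only coordinate \<open>p\<close> lowered and move the other coordinates from
  \<open>c\<close> to \<open>X i\<close> one at a time. Each move combines one more loss, and the
  embedding turns combination into addition.\<close>

lemma embed_loss:
  assumes X: "X \<in> below"
  shows "embed (loss p X) = - (\<Sum>i\<in>I. score i (X i))"
proof -
  let ?Y = "\<lambda>J i. if i = p \<or> i \<in> J then X i else c"
  have *: "embed (loss p (?Y J)) = - (\<Sum>i\<in>insert p J. score i (X i))" if "finite J" "J \<subseteq> I - {p}" for J
    using that
  proof (induction J)
    case empty
    have "?Y {} = single p (c - X p)" by (auto simp: single_def)
    then show ?case by (simp add: score_def)
  next
    case (insert i J)
    have i: "i \<in> I" "i \<noteq> p" "i \<notin> J" and Xi: "X i \<le> c" using insert X by (auto simp: below_def)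
    have Y: "?Y J \<in> below" using X by (auto simp: below_def)
    have "?Y (insert i J) = (?Y J)(i := c - (c - X i))" by auto
    then have "loss p (?Y (insert i J)) = loss p (?Y J) \<diamondop> loss p (single i (c - X i))"
      using loss_upd[OF Y, of i "c - X i"] i Xi by simp
    then have "embed (loss p (?Y (insert i J))) = embed (loss p (?Y J)) - score i (X i)"
      using Y i Xi pqr by (simp add: embed_op loss_nonneg single_below score_def)
    with insert i show ?case by (simp add: insert_commute[of p i])
  qed
  have eq: "insert p (I - {p}) = I" using pqr by auto
  have "loss p X = loss p (?Y (I - {p}))"
    using X pqr by (intro loss_eq ind_cong) (auto simp: below_def)
  with *[of "I - {p}"] show ?thesis using finite_index unfolding eq by simp
qed

lemma additive_below_score: "additive_below c score"
  unfolding additive_below_def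
proof (intro allI impI)
  fix X Y assume "\<forall>i\<in>I. X i \<le> c" "\<forall>i\<in>I. Y i \<le> c"
  then have XY: "X \<in> below" "Y \<in> below" by (auto simp: below_def)
  then have nn: "0 \<le> loss p X" "0 \<le> loss p Y" using loss_nonneg pqr by auto
  have "P X Y \<longleftrightarrow> loss p X \<le> loss p Y" using XY pqr by (intro loss_le_iff)
  also have "\<dots> \<longleftrightarrow> embed (loss p X) \<le> embed (loss p Y)"
    using embed_strict_mono nn by (metis linorder_not_less order_le_less)
  finally show "P X Y \<longleftrightarrow> (\<Sum>i\<in>I. score i (Y i)) \<le> (\<Sum>i\<in>I. score i (X i))"
    using XY by (simp add: embed_loss)
qed

text \<open>Under any additive representation the utility lost by a loss in \<open>p\<close> is
  strictly increasing and additive for \<diamondop>, so Hoelder uniqueness makes it a multiple of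
  \<open>embed\<close>. A loss in \<open>i\<close> costs as much as its equivalent in
  \<open>p\<close>, so all coordinates share the factor \<open>h 1\<close>.\<close>

lemma additive_below_unique:
  assumes f: "additive_below c f"
  shows "\<exists>k>0. \<forall>i\<in>I. \<forall>x\<le>c. f i x = f i c + k * score i x"
proof -
  let ?U = "\<lambda>X. \<Sum>i\<in>I. f i (X i)"
  have rep: "P X Y \<longleftrightarrow> ?U Y \<le> ?U X" if "X \<in> below" "Y \<in> below" for X Y
    using f that unfolding additive_below_def below_def by blast
  have upd: "?U (X(i := t)) = ?U X - f i (X i) + f i t" if "i \<in> I" for X i t
  proof -
    have "(\<Sum>j\<in>I - {i}. f j ((X(i := t)) j)) = (\<Sum>j\<in>I - {i}. f j (X j))" by (intro sum.cong) auto
    then show ?thesis using that finite_index by (simp add: sum.remove[of I i])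
  qed
  have U_single: "?U (single i l) = ?U (\<lambda>_. c) - f i c + f i (c - l)" if "i \<in> I" for i l
    unfolding single_def using upd[OF that, of "\<lambda>_. c"] by simp
  define h where "h a = f p c - f p (c - a)" for a
  have hl: "f i c - f i (c - l) = h (loss p (single i l))" if "i \<in> I" "0 \<le> l" for i l
  proof -
    have "ind (single p (loss p (single i l))) (single i l)" using that pqr by (intro ind_loss) auto
    then have "?U (single p (loss p (single i l))) = ?U (single i l)"
      using rep that pqr by (auto simp: ind_def loss_nonneg single_below intro!: antisym)
    then show ?thesis using that pqr by (simp add: U_single h_def)
  qed
  have h_mono: "h a < h b" if "0 \<le> a" "a < b" for a b
  proof -
    have "\<not> P (single p b) (single p a)" using that pqr by (simp add: single_le_iff)
    then show ?thesis using rep[of "single p b" "single p a"] that pqr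
      by (simp add: U_single h_def single_below)
  qed
  have h_add: "h (a \<diamondop> b) = h a + h b" if nn: "0 \<le> a" "0 \<le> b" for a b
  proof -
    obtain l where l: "0 \<le> l" "loss p (single q l) = b" using ex_single pqr nn by metis
    have ab: "a \<diamondop> b = loss p ((single p a)(q := c - l))"
      using comb_single[of a l q] l nn pqr by simp
    have "ind (single p (a \<diamondop> b)) ((single p a)(q := c - l))"
      unfolding ab using nn l pqr by (intro ind_loss) auto
    then have "?U (single p (a \<diamondop> b)) = ?U ((single p a)(q := c - l))"
      using rep[of "single p (a \<diamondop> b)" "(single p a)(q := c - l)"]
        rep[of "(single p a)(q := c - l)" "single p (a \<diamondop> b)"] comb_nonneg[OF nn] nn l pqr
      by (auto simp: ind_def single_below below_upd)
    also have "\<dots> = ?U (single p a) - f q c + f q (c - l)"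
      using upd[of q "single p a"] pqr by simp
    finally show ?thesis using hl[of q l] l pqr by (simp add: U_single h_def)
  qed
  have "0 < h 1" using h_mono[of 0 1] by (simp add: h_def)
  moreover have "f i x = f i c + h 1 * score i x" if "i \<in> I" "x \<le> c" for i x
    using hl[of i "c - x"] embed_unique[of h "loss p (single i (c - x))"] h_add h_mono that pqr
    by (simp add: score_def loss_nonneg single_below)
  ultimately show ?thesis by blast
qed

end

section \<open>Gluing the representations for all bounds\<close>

context separable_preference
begin

lemma ex_additive_below: "\<exists>f. additive_below c f"
  and additive_below_proportional: "additive_below c f \<Longrightarrow> additive_below c g \<Longrightarrow>
     \<exists>k>0. \<forall>i\<in>I. \<forall>x\<le>c. g i x - g i c = k * (f i x - f i c)"
proof -
  obtain p q r where "p \<in> I" "q \<in> I" "r \<in> I" "p \<noteq> q" "p \<noteq> r" "q \<noteq> r"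
    using obtain_subset_with_card_n[OF card_index] by (metis card_3_iff insert_subset)
  then interpret separable_preference_below I P c p q r by unfold_locales
  show "\<exists>f. additive_below c f" using additive_below_score by blast
  assume "additive_below c f" "additive_below c g"
  then obtain k l where k: "k > 0" "\<forall>i\<in>I. \<forall>x\<le>c. f i x = f i c + k * score i x"
    and l: "l > 0" "\<forall>i\<in>I. \<forall>x\<le>c. g i x = g i c + l * score i x"
    using additive_below_unique by meson
  have "g i x - g i c = (l / k) * (f i x - f i c)" if "i \<in> I" "x \<le> c" for i x
  proof -
    have "g i x - g i c = l * score i x" "f i x - f i c = k * score i x"
      using k(2) l(2) that by (metis add_diff_cancel_left')+
    then show ?thesis using k by simp
  qed
  moreover have "0 < l / k" using k(1) l(1) by simp
  ultimately show "\<exists>k>0. \<forall>i\<in>I. \<forall>x\<le>c. g i x - g i c = k * (f i x - f i c)"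
    by blast
qed

lemma additive_below_antimono: "additive_below d f \<Longrightarrow> c \<le> d \<Longrightarrow> additive_below c f"
  unfolding additive_below_def by (meson order_trans)

lemma additive_below_strict_mono:
  assumes f: "additive_below c f" and i: "i \<in> I" and xy: "x < y" "y \<le> c"
  shows "f i x < f i y"
proof -
  let ?X = "\<lambda>t. (\<lambda>_. c)(i := t)"
  have "\<not> P (?X x) (?X y)" using xy i by (intro strict[where i = i]) auto
  then have "(\<Sum>j\<in>I. f j (?X x j)) < (\<Sum>j\<in>I. f j (?X y j))"
    using f xy unfolding additive_below_def by (auto simp: not_le)
  moreover have "(\<Sum>j\<in>I. f j (?X t j)) = f i t + (\<Sum>j\<in>I - {i}. f j c)" for t
    using i finite_index by (subst sum.remove[of I i]) (auto intro!: sum.cong)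
  ultimately show ?thesis by simp
qed

theorem additive_representation:
  "\<exists>f :: 'i \<Rightarrow> real \<Rightarrow> real. (\<forall>X Y. P X Y \<longleftrightarrow> (\<Sum>i\<in>I. f i (Y i)) \<le> (\<Sum>i\<in>I. f i (X i))) \<and> (\<forall>i\<in>I. strict_mono (f i))"
proof -
  obtain p where p: "p \<in> I" using card_index by fastforce
  define F where "F c = (SOME f. additive_below c f)" for c
  have F: "additive_below c (F c)" for c
    unfolding F_def using ex_additive_below by (rule someI_ex)
  \<comment> \<open>Each summand is made to vanish at 0, and the rise of summand \<open>p\<close>
    from -1 to 0 becomes the unit. Both points lie below every \<open>c \<ge> 0\<close>, so the
    common factor relating two bounds cancels.\<close>
  define G where "G c i x = (F c i x - F c i 0) / (F c p 0 - F c p (- 1))" for c i x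
  have pos: "0 < F c p 0 - F c p (- 1)" if "0 \<le> c" for c
    using additive_below_strict_mono[OF F p, of "- 1" 0 c] that by simp
  have G: "additive_below c (G c)" if "0 \<le> c" for c
    unfolding additive_below_def
  proof (intro allI impI)
    fix X Y assume *: "\<forall>i\<in>I. X i \<le> c" "\<forall>i\<in>I. Y i \<le> c"
    let ?k = "F c p 0 - F c p (- 1)"
    have "(\<Sum>i\<in>I. G c i (Z i)) = ((\<Sum>i\<in>I. F c i (Z i)) - (\<Sum>i\<in>I. F c i 0)) / ?k" for Z
      by (simp add: G_def sum_subtractf flip: sum_divide_distrib)
    then show "P X Y \<longleftrightarrow> (\<Sum>i\<in>I. G c i (Y i)) \<le> (\<Sum>i\<in>I. G c i (X i))"
      using F[of c] * pos[OF that] by (simp add: additive_below_def divide_le_cancel)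
  qed
  have G_eq: "G d i x = G c i x" if "0 \<le> c" "c \<le> d" "i \<in> I" "x \<le> c" for c d i x
  proof -
    obtain k where k: "k > 0" "\<forall>i\<in>I. \<forall>x\<le>c. F d i x - F d i c = k * (F c i x - F c i c)"
      using additive_below_proportional[OF F additive_below_antimono[OF F]] \<open>c \<le> d\<close> by blast
    have diff: "F d i x - F d i y = k * (F c i x - F c i y)" if "i \<in> I" "x \<le> c" "y \<le> c" for i x y
    proof -
      have "F d i x - F d i y = (F d i x - F d i c) - (F d i y - F d i c)" by simp
      also have "\<dots> = k * (F c i x - F c i y)" using k(2) that by (simp add: right_diff_distrib)
      finally show ?thesis .
    qed
    show ?thesis unfolding G_def using that p k(1) by (simp add: diff)
  qed
  \<comment> \<open>By \<open>G_eq\<close> every nonnegative bound above \<open>x\<close> gives the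
    same value; \<open>max x 0\<close> is the smallest such bound.\<close>
  define f where "f i x = G (max x 0) i x" for i x
  have f: "f i x = G c i x" if "0 \<le> c" "i \<in> I" "x \<le> c" for c i x
    unfolding f_def using G_eq[of "max x 0" c i x] that by simp
  show ?thesis
  proof (intro exI[of _ f] conjI allI ballI)
    fix X Y :: "'i \<Rightarrow> real"
    define c where "c = (\<Sum>i\<in>I. \<bar>X i\<bar> + \<bar>Y i\<bar>)"
    have c: "\<bar>X i\<bar> + \<bar>Y i\<bar> \<le> c" if "i \<in> I" for i
      unfolding c_def using that finite_index by (intro member_le_sum) auto
    have 0: "0 \<le> c" by (simp add: c_def sum_nonneg)
    have le: "X i \<le> c" "Y i \<le> c" if "i \<in> I" for i using c[OF that] by auto
    then have "P X Y \<longleftrightarrow> (\<Sum>i\<in>I. G c i (Y i)) \<le> (\<Sum>i\<in>I. G c i (X i))"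
      using G[OF 0] by (auto simp: additive_below_def)
    then show "P X Y \<longleftrightarrow> (\<Sum>i\<in>I. f i (Y i)) \<le> (\<Sum>i\<in>I. f i (X i))"
      using f[OF 0] le by simp
  next
    fix i assume i: "i \<in> I"
    show "strict_mono (f i)"
    proof
      fix x y :: real assume "x < y"
      then show "f i x < f i y"
        using additive_below_strict_mono[OF G i, of "max y 0" x y] f[of "max y 0" i] i by simp
    qed
  qed
qed

end

section \<open>Continuity, concavity and proportionality of the summands\<close>

context separable_preference
begin

text \<open>Another summand \<open>f j\<close> is monotone, so it is continuous at some
  \<open>y\<close>, and raising \<open>y\<close> by a small \<open>k\<close> costs less than
  \<open>e\<close>. This makes one vector strictly better than another, and closedness keeps the
  comparison when coordinate \<open>i\<close> moves slightly. Doing this in both directions bounds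
  the change of \<open>f i\<close> by \<open>e\<close>.\<close>

lemma additive_continuous:
  fixes f :: "'i \<Rightarrow> real \<Rightarrow> real"
  assumes rep: "\<And>X Y. P X Y \<longleftrightarrow> (\<Sum>i\<in>I. f i (Y i)) \<le> (\<Sum>i\<in>I. f i (X i))"
    and sm: "\<And>i. i \<in> I \<Longrightarrow> strict_mono (f i)"
    and i: "i \<in> I"
  shows "isCont (f i) x"
  unfolding continuous_at_eps_delta
proof (intro allI impI)
  fix e :: real assume e: "0 < e"
  have "1 < card I" using card_index by simp
  then obtain j where j: "j \<in> I" "j \<noteq> i"
    by (metis card_1_singleton_iff is_singletonI' is_singleton_altdef i less_irrefl empty_iff One_nat_def)
  have "countable {a. \<not> isCont (f j) a}"
    using sm[OF j(1)] by (intro mono_ctble_discont strict_mono_mono)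
  then have "{a. \<not> isCont (f j) a} \<noteq> UNIV" using uncountable_UNIV_real by metis
  then obtain y where "isCont (f j) y" by blast
  then obtain d where d: "d > 0" "\<And>z. dist z y < d \<Longrightarrow> dist (f j z) (f j y) < e"
    using e unfolding continuous_at_eps_delta by blast
  define k where "k = d / 2"
  have k: "0 < k" "f j (y + k) - f j y < e"
    using d(1) d(2)[of "y + k"] by (auto simp: k_def dist_real_def)
  define Z where "Z s t = (\<lambda>_. 0 :: real)(i := s, j := t)" for s t
  have U: "(\<Sum>l\<in>I. f l (Z s t l)) = f i s + f j t + (\<Sum>l\<in>I - {i} - {j}. f l 0)" for s t
    using i j finite_index by (simp add: Z_def sum.remove[of I i] sum.remove[of "I - {i}" j])
  let ?V = "(\<lambda>_. 0 :: real)(i := 1)"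
  have line: "(\<lambda>l. Z s t l + h * ?V l) = Z (s + h) t" for s t h using j by (auto simp: Z_def fun_eq_iff)
  have "open (- {t. P (\<lambda>l. Z x y l + t * ?V l) (Z x (y + k))})" (is "open ?A")
    using closed_upper by (simp only: open_Compl)
  moreover have "open (- {t. P (Z x y) (\<lambda>l. Z x (y + k) l + t * ?V l)})" (is "open ?B")
    using closed_lower by (simp only: open_Compl)
  moreover have "0 \<in> ?A \<inter> ?B"
    using strict_monoD[OF sm[OF j(1)], of y "y + k"] k unfolding line by (simp add: rep U)
  ultimately obtain r where r: "r > 0" "ball 0 r \<subseteq> ?A \<inter> ?B" by (meson open_Int open_contains_ball)
  have "dist (f i z) (f i x) < e" if "dist z x < r" for z
  proof -
    have "z - x \<in> ?A \<inter> ?B" using that r(2) by (auto simp: dist_real_def subset_iff)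
    then show ?thesis using k unfolding line by (auto simp: rep U dist_real_def not_le)
  qed
  with r(1) show "\<exists>d>0. \<forall>z. dist z x < d \<longrightarrow> dist (f i z) (f i x) < e" by blast
qed

text \<open>Directions supported on \<open>i\<close> and \<open>j\<close> leave all other
  coordinates at the diagonal value \<open>c\<close>, so the contribution \<open>K c\<close> cancels
  from every comparison.\<close>

lemma additive_separable_pair:
  fixes f :: "'i \<Rightarrow> real \<Rightarrow> real"
  assumes rep: "\<And>X Y. P X Y \<longleftrightarrow> (\<Sum>i\<in>I. f i (Y i)) \<le> (\<Sum>i\<in>I. f i (X i))"
    and sm: "\<And>i. i \<in> I \<Longrightarrow> strict_mono (f i)"
    and direction: "\<And>\<alpha> c X c'. 0 < \<alpha> \<Longrightarrow> P (\<lambda>i. c + \<alpha> * X i) (\<lambda>_. c) \<Longrightarrow>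
      \<exists>\<beta>>0. P (\<lambda>i. c' + \<beta> * X i) (\<lambda>_. c')"
    and ij: "i \<in> I" "j \<in> I" "i \<noteq> j"
  shows "separable_pair (f i) (f j)"
proof
  define Z where "Z c s t = (\<lambda>_. c :: real)(i := s, j := t)" for c s t
  define K where "K c = (\<Sum>l\<in>I - {i} - {j}. f l c)" for c
  have U: "(\<Sum>l\<in>I. f l (Z c s t l)) = f i s + f j t + K c" for c s t
    using ij finite_index by (simp add: Z_def K_def sum.remove[of I i] sum.remove[of "I - {i}" j])
  show "v \<le> f i (t * x + (1 - t) * x') + f j (t * y + (1 - t) * y')"
    if le: "v \<le> f i x + f j y" "v \<le> f i x' + f j y'" and t: "0 \<le> t" "t \<le> 1" for v x y x' y' t
  proof -
    have mix: "(\<lambda>l. t * Z 0 x y l + (1 - t) * Z 0 x' y' l)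
        = Z 0 (t * x + (1 - t) * x') (t * y + (1 - t) * y')" for t x y x' y'
      by (auto simp: Z_def fun_eq_iff)
    consider "P (Z 0 x y) (Z 0 x' y')" | "P (Z 0 x' y') (Z 0 x y)" using total by blast
    then show ?thesis
    proof cases
      case 1
      from quasiconcave[OF this t] show ?thesis unfolding mix using le by (simp add: rep U)
    next
      case 2
      from quasiconcave[OF this, of "1 - t"] t have
        "P (\<lambda>l. (1 - t) * Z 0 x' y' l + (1 - (1 - t)) * Z 0 x y l) (Z 0 x y)" by simp
      then show ?thesis unfolding mix using le by (simp add: rep U add.commute)
    qed
  qed
  show "\<exists>\<beta>>0. f i c' + f j c' \<le> f i (c' + \<beta> * a) + f j (c' + \<beta> * b)"
    if \<alpha>: "0 < \<alpha>" "f i c + f j c \<le> f i (c + \<alpha> * a) + f j (c + \<alpha> * b)" for \<alpha> c a b c'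
  proof -
    have line: "(\<lambda>l. c + \<beta> * Z 0 a b l) = Z c (c + \<beta> * a) (c + \<beta> * b)" for \<beta> c
      by (auto simp: Z_def fun_eq_iff)
    have Uc: "(\<Sum>l\<in>I. f l c) = f i c + f j c + K c" for c
      using ij finite_index by (simp add: K_def sum.remove[of I i] sum.remove[of "I - {i}" j])
    have PZ: "P (\<lambda>l. c + \<beta> * Z 0 a b l) (\<lambda>_. c) \<longleftrightarrow> f i c + f j c \<le> f i (c + \<beta> * a) + f j (c + \<beta> * b)" for c \<beta>
      unfolding line rep U Uc by simp
    show ?thesis using direction[OF \<alpha>(1), of c "Z 0 a b" c'] \<alpha>(2) unfolding PZ by blast
  qed
  show "strict_mono (f i)" "strict_mono (f j)" using sm ij by auto
  show "continuous_on UNIV (f i)" "continuous_on UNIV (f j)"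
    using additive_continuous[OF rep sm] ij by (auto intro: continuous_at_imp_continuous_on)
qed

theorem concave_representation:
  assumes direction: "\<forall>\<alpha> c X c'. 0 < \<alpha> \<longrightarrow> P (\<lambda>i. c + \<alpha> * X i) (\<lambda>_. c) \<longrightarrow>
      (\<exists>\<beta>>0. P (\<lambda>i. c' + \<beta> * X i) (\<lambda>_. c'))"
    and nonlinear: "P X0 Y0" "P Y0 X0" "\<not> P X0 (\<lambda>i. a0 * X0 i + (1 - a0) * Y0 i)"
  shows "\<exists>(u :: real \<Rightarrow> real) w. strictly_concave u \<and> strict_mono u \<and> u differentiable_on UNIV \<and>
    (\<forall>i\<in>I. 0 < w i) \<and> sum w I = 1 \<and>
    (\<forall>X Y. P X Y \<longleftrightarrow> (\<Sum>i\<in>I. u (Y i) * w i) \<le> (\<Sum>i\<in>I. u (X i) * w i))"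
proof -
  obtain f :: "'i \<Rightarrow> real \<Rightarrow> real"
    where rep: "\<And>X Y. P X Y \<longleftrightarrow> (\<Sum>i\<in>I. f i (Y i)) \<le> (\<Sum>i\<in>I. f i (X i))"
      and sm: "\<And>i. i \<in> I \<Longrightarrow> strict_mono (f i)"
    using additive_representation by blast
  have pair: "separable_pair (f i) (f j)" if "i \<in> I" "j \<in> I" "i \<noteq> j" for i j
    by (rule additive_separable_pair[OF rep sm direction[rule_format] that])
  obtain p q r where pqr: "p \<in> I" "q \<in> I" "r \<in> I" "p \<noteq> q" "p \<noteq> r" "q \<noteq> r"
    using obtain_subset_with_card_n[OF card_index] by (metis card_3_iff insert_subset)
  have conc: "concave_on UNIV (f i) \<or> concave_on UNIV (f j)" if "i \<in> I" "j \<in> I" "i \<noteq> j" for i j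
    using separable_pair.one_concave[OF pair[OF that]] .
  \<comment> \<open>Of any two summands one is concave, so among three at least two are.\<close>
  obtain j k where jk: "j \<in> I" "k \<in> I" "j \<noteq> k" "concave_on UNIV (f j)" "concave_on UNIV (f k)"
    using conc[of p q] conc[of p r] conc[of q r] pqr by metis
  obtain s where s: "\<And>c. (f j has_real_derivative s c) (at c)"
    using separable_pair.concave_imp_proportional[OF pair[OF jk(1-3)] jk(4,5)] by blast
  have s_pos: "0 < s c" for c
    using supergradient_pos[OF sm[OF jk(1)] derivative_supergradient[OF jk(4) s]] .
  have "\<exists>k m. 0 < k \<and> (\<forall>x. f i x = k * f j x + m)" if i: "i \<in> I" for i
  proof (cases "i = j")
    case True
    then show ?thesis by (intro exI[of _ 1] exI[of _ 0]) simp
  next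
    case False
    with jk(1) i have ji: "separable_pair (f j) (f i)" by (intro pair) auto
    have "concave_on UNIV (f i)"
      using separable_pair.concave_if_other_differentiable[OF ji s s_pos jk(4)] .
    from separable_pair.concave_imp_proportional[OF ji jk(4) this] show ?thesis by blast
  qed
  then obtain \<kappa> m where \<kappa>: "\<And>i. i \<in> I \<Longrightarrow> 0 < \<kappa> i" "\<And>i x. i \<in> I \<Longrightarrow> f i x = \<kappa> i * f j x + m i"
    by metis
  \<comment> \<open>Affine summands would make every mixture of indifferent vectors indifferent to
    them, against \<open>nonlinear\<close>.\<close>
  have affine: "\<nexists>A B. \<forall>x. f j x = A * x + B"
  proof
    assume "\<exists>A B. \<forall>x. f j x = A * x + B"
    then obtain A B where AB: "\<And>x. f j x = A * x + B" by blast
    let ?U = "\<lambda>X. \<Sum>i\<in>I. f i (X i)"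
    have "f i (a0 * x + (1 - a0) * y) = a0 * f i x + (1 - a0) * f i y" if "i \<in> I" for i x y
      using that by (simp add: \<kappa>(2) AB algebra_simps)
    then have "?U (\<lambda>i. a0 * X0 i + (1 - a0) * Y0 i) = a0 * ?U X0 + (1 - a0) * ?U Y0"
      by (simp add: sum.distrib sum_distrib_left)
    also have "?U Y0 = ?U X0" using nonlinear(1,2) by (simp add: rep)
    also have "a0 * ?U X0 + (1 - a0) * ?U X0 = ?U X0" by (simp add: algebra_simps)
    finally show False using nonlinear(3) by (simp add: rep)
  qed
  have sc: "strictly_concave (f j)"
    using separable_pair.strictly_concave_or_affine[OF pair[OF jk(1-3)] s jk(4) \<kappa>(2)[OF jk(2)] \<kappa>(1)[OF jk(2)]]
      affine by blast
  define S where "S = sum \<kappa> I"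
  have S: "0 < S" unfolding S_def using \<kappa>(1) jk(1) finite_index by (intro sum_pos) auto
  define w where "w i = \<kappa> i / S" for i
  have "(\<Sum>i\<in>I. f i (X i)) = S * (\<Sum>i\<in>I. f j (X i) * w i) + sum m I" for X
    using S by (simp add: \<kappa>(2) w_def sum.distrib sum_distrib_left mult.commute)
  then have "P X Y \<longleftrightarrow> (\<Sum>i\<in>I. f j (Y i) * w i) \<le> (\<Sum>i\<in>I. f j (X i) * w i)" for X Y
    using S by (simp add: rep)
  moreover have "sum w I = 1" using S by (simp add: w_def S_def flip: sum_divide_distrib)
  moreover have "f j differentiable_on UNIV"
    using s by (meson differentiable_on_def differentiable_at_withinI real_differentiable_def)
  moreover have "\<forall>i\<in>I. 0 < w i" using \<kappa>(1) S by (simp add: w_def)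
  ultimately show ?thesis using sc sm[OF jk(1)] by blast
qed

end

section \<open>Discounted sums of bounded sequences\<close>

lemma disc_sum_add:
  "\<delta> \<in> {0<..<1} \<Longrightarrow> disc_sum \<delta> (x + y) = disc_sum \<delta> x + disc_sum \<delta> y"
  by (simp add: disc_sum_def plus_bcontfun.rep_eq distrib_left suminf_add summable_disc_sum)

lemma disc_sum_scaleR:
  "\<delta> \<in> {0<..<1} \<Longrightarrow> disc_sum \<delta> (r *\<^sub>R x) = r * disc_sum \<delta> x"
  using suminf_mult[OF summable_disc_sum, of \<delta> r x]
  by (simp add: disc_sum_def scaleR_bcontfun.rep_eq mult.left_commute)

lemma bounded_linear_disc_sum:
  assumes "\<delta> \<in> {0<..<1}"
  shows "bounded_linear (disc_sum \<delta>)"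
proof (rule bounded_linear_intro)
  fix x :: linf
  have le: "norm (\<delta> ^ t * apply_bcontfun x t) \<le> norm x * \<delta> ^ t" for t
    using assms norm_bounded[of x t] by (auto simp: abs_mult power_abs mult.commute intro!: mult_right_mono)
  have geo: "summable (\<lambda>t. norm x * \<delta> ^ t)" using assms by (intro summable_mult summable_geometric) auto
  have "norm (disc_sum \<delta> x) \<le> (\<Sum>t. norm (\<delta> ^ t * apply_bcontfun x t))"
    unfolding disc_sum_def
    by (intro summable_norm summable_comparison_test'[OF geo]) (use le in simp)
  also have "\<dots> \<le> (\<Sum>t. norm x * \<delta> ^ t)"
    by (intro suminf_le le summable_comparison_test'[OF geo] geo) (use le in simp)
  also have "\<dots> = norm x * (\<Sum>t. \<delta> ^ t)" using assms by (intro suminf_mult summable_geometric) auto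
  finally show "norm (disc_sum \<delta> x) \<le> norm x * (\<Sum>t. \<delta> ^ t)" .
qed (use assms in \<open>simp_all add: disc_sum_add disc_sum_scaleR\<close>)

text \<open>The coefficient sequence has finitely many nonzero terms, hence is bounded, and its
  discounted sum is the value of the polynomial.\<close>

lemma ex_linf_poly: "\<exists>x. \<forall>\<delta>. disc_sum \<delta> x = poly p \<delta>"
proof (intro exI allI)
  fix \<delta> :: real
  let ?x = "Bcontfun (coeff p) :: linf"
  have "finite (range (coeff p))"
  proof (rule finite_subset)
    show "range (coeff p) \<subseteq> insert 0 (coeff p ` {..degree p})"
      using coeff_eq_0[of p] by (metis (no_types, lifting) image_subsetI insertCI imageI atMost_iff not_le)
  qed simp
  then have "coeff p \<in> bcontfun" by (simp add: linf_iff_bounded finite_imp_bounded)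
  then have x: "apply_bcontfun ?x = coeff p" by (rule Bcontfun_inverse)
  have "disc_sum \<delta> ?x = (\<Sum>t\<le>degree p. \<delta> ^ t * coeff p t)"
    unfolding disc_sum_def x by (rule suminf_finite) (auto simp: coeff_eq_0)
  then show "disc_sum \<delta> ?x = poly p \<delta>" by (simp add: poly_altdef mult.commute)
qed

lemma ex_dual_basis:
  assumes "finite D"
  shows "\<exists>e. \<forall>\<delta>\<in>D. \<forall>\<delta>'\<in>D. disc_sum \<delta>' (e \<delta>) = (if \<delta>' = \<delta> then 1 else 0)"
proof -
  have "\<exists>x. \<forall>\<delta>'\<in>D. disc_sum \<delta>' x = (if \<delta>' = \<delta> then 1 else 0)" if "\<delta> \<in> D" for \<delta>
  proof -
    \<comment> \<open>The Lagrange polynomial of \<open>\<delta>\<close> before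
      normalisation.\<close>
    let ?q = "\<Prod>a\<in>D - {\<delta>}. [:- a, 1:]"
    obtain x where x: "\<And>\<delta>'. disc_sum \<delta>' x = poly (smult (1 / poly ?q \<delta>) ?q) \<delta>'"
      using ex_linf_poly by blast
    have "poly ?q \<delta> \<noteq> 0" using assms by (auto simp: poly_prod)
    moreover have "poly ?q \<delta>' = 0" if "\<delta>' \<in> D" "\<delta>' \<noteq> \<delta>" for \<delta>'
      using that assms by (auto simp: poly_prod)
    ultimately show ?thesis by (intro exI[of _ x]) (simp add: x)
  qed
  then show ?thesis by metis
qed

lemma disc_sum_linf0:
  assumes "z \<in> linf0"
  shows "disc_sum \<delta> z = apply_bcontfun z 0"
proof -
  have "disc_sum \<delta> z = (\<Sum>t\<in>{0}. \<delta> ^ t * apply_bcontfun z t)"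
    unfolding disc_sum_def using assms by (intro suminf_finite) (auto simp: linf0_def)
  then show ?thesis by simp
qed

lemma ex_linf0: "\<exists>z\<in>linf0. apply_bcontfun z 0 = c"
proof -
  let ?f = "\<lambda>t::nat. if t = 0 then c else 0"
  have "range ?f \<subseteq> {0, c}" by auto
  then have "?f \<in> bcontfun" by (metis linf_iff_bounded finite.emptyI finite_insert finite_subset finite_imp_bounded)
  then have "apply_bcontfun (Bcontfun ?f) = ?f" by (rule Bcontfun_inverse)
  then show ?thesis by (intro bexI[of _ "Bcontfun ?f"]) (auto simp: linf0_def)
qed

lemma strictly_concave_weak:
  assumes "strictly_concave u" "0 \<le> \<alpha>" "\<alpha> \<le> 1"
  shows "\<alpha> * u a + (1 - \<alpha>) * u b \<le> u (\<alpha> * a + (1 - \<alpha>) * b)"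
proof -
  consider "\<alpha> = 0" | "\<alpha> = 1" | "a = b" | "0 < \<alpha>" "\<alpha> < 1" "a \<noteq> b" using assms(2,3) by linarith
  then show ?thesis
  proof cases
    case 4
    then show ?thesis using assms(1) unfolding strictly_concave_def by (simp add: less_imp_le)
  qed (simp_all add: algebra_simps)
qed

lemma strictly_concave_imp_concave:
  assumes "strictly_concave u"
  shows "concave_on UNIV u"
  unfolding concave_on_iff
proof (intro conjI ballI allI impI)
  fix x y p q :: real assume "0 \<le> p" "0 \<le> q" "p + q = 1"
  then have "q = 1 - p" "0 \<le> p" "p \<le> 1" by auto
  then show "p * u x + q * u y \<le> u (p *\<^sub>R x + q *\<^sub>R y)"
    using strictly_concave_weak[OF assms] by simp
qed simp

text \<open>If \<open>u\<close> reached its tangent at \<open>y\<close>, strict concavity would lift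
  it above the tangent at the midpoint of \<open>y\<close> and \<open>c\<close>.\<close>

lemma strictly_concave_tangent:
  assumes u: "strictly_concave u" and du: "(u has_real_derivative s) (at c)" and "y \<noteq> c"
  shows "u y < u c + s * (y - c)"
proof -
  have sg: "u z \<le> u c + s * (z - c)" for z
    using derivative_supergradient[OF strictly_concave_imp_concave[OF u] du]
    by (simp add: supergradient_def)
  have "1 / 2 * u y + (1 - 1 / 2) * u c < u (1 / 2 * y + (1 - 1 / 2) * c)"
    using \<open>y \<noteq> c\<close> by (intro u[unfolded strictly_concave_def, rule_format]) auto
  with sg[of "1 / 2 * y + (1 - 1 / 2) * c"] show ?thesis by (simp add: algebra_simps)
qed

section \<open>The representation implies the axioms\<close>

locale utilitarian =
  fixes D :: "real set" and u :: "real \<Rightarrow> real" and w :: "real \<Rightarrow> real"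
  assumes finite_D: "finite D" and D: "D \<subseteq> {0<..<1}"
    and u: "strictly_concave u" "strict_mono u" "u differentiable_on UNIV"
    and w: "\<And>\<delta>. \<delta> \<in> D \<Longrightarrow> 0 < w \<delta>" "sum w D = 1"
begin

definition welfare :: "linf \<Rightarrow> real" where
  "welfare x = (\<Sum>\<delta>\<in>D. u (disc_sum \<delta> x) * w \<delta>)"

lemma disc_sum_simps [simp]:
  "\<delta> \<in> D \<Longrightarrow> disc_sum \<delta> (x + y) = disc_sum \<delta> x + disc_sum \<delta> y"
  "\<delta> \<in> D \<Longrightarrow> disc_sum \<delta> (r *\<^sub>R x) = r * disc_sum \<delta> x"
  using D by (auto intro: disc_sum_add disc_sum_scaleR)

lemma welfare_cong: "(\<And>\<delta>. \<delta> \<in> D \<Longrightarrow> disc_sum \<delta> x = disc_sum \<delta> y) \<Longrightarrow> welfare x = welfare y"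
  unfolding welfare_def by (intro sum.cong) auto

lemma welfare_mono:
  assumes le: "\<And>\<delta>. \<delta> \<in> D \<Longrightarrow> disc_sum \<delta> y \<le> disc_sum \<delta> x"
  shows "welfare y \<le> welfare x"
    and "\<delta> \<in> D \<Longrightarrow> disc_sum \<delta> y < disc_sum \<delta> x \<Longrightarrow> welfare y < welfare x"
proof -
  have *: "u (disc_sum \<delta> y) * w \<delta> \<le> u (disc_sum \<delta> x) * w \<delta>" if "\<delta> \<in> D" for \<delta>
    using le[OF that] w(1)[OF that] strict_mono_less_eq[OF u(2)] by simp
  then show "welfare y \<le> welfare x" unfolding welfare_def by (intro sum_mono)
  show "welfare y < welfare x" if "\<delta> \<in> D" "disc_sum \<delta> y < disc_sum \<delta> x"
    unfolding welfare_def using * that w(1)[OF that(1)] strict_mono_less[OF u(2)]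
    by (intro sum_strict_mono_ex1[OF finite_D]) (auto intro!: bexI[of _ \<delta>])
qed

lemma continuous_welfare: "continuous_on UNIV welfare"
proof -
  have "continuous_on UNIV (\<lambda>x. u (disc_sum \<delta> x))" if "\<delta> \<in> D" for \<delta>
  proof (rule continuous_on_compose2[of UNIV u UNIV "disc_sum \<delta>"])
    show "continuous_on UNIV u" using u(3) by (rule differentiable_imp_continuous_on)
    show "continuous_on UNIV (disc_sum \<delta>)"
      using D that by (intro linear_continuous_on bounded_linear_disc_sum) auto
  qed simp
  then show ?thesis unfolding welfare_def by (intro continuous_intros)
qed

lemma welfare_concave:
  assumes a: "0 \<le> a" "a \<le> 1"
  shows "a * welfare x + (1 - a) * welfare y \<le> welfare (a *\<^sub>R x + (1 - a) *\<^sub>R y)"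
    and "0 < a \<Longrightarrow> a < 1 \<Longrightarrow> \<delta> \<in> D \<Longrightarrow> disc_sum \<delta> x \<noteq> disc_sum \<delta> y \<Longrightarrow>
      a * welfare x + (1 - a) * welfare y < welfare (a *\<^sub>R x + (1 - a) *\<^sub>R y)"
proof -
  have eq: "a * welfare x + (1 - a) * welfare y
      = (\<Sum>\<delta>\<in>D. (a * u (disc_sum \<delta> x) + (1 - a) * u (disc_sum \<delta> y)) * w \<delta>)"
    by (simp add: welfare_def sum_distrib_left distrib_right mult.assoc flip: sum.distrib)
  have eq': "welfare (a *\<^sub>R x + (1 - a) *\<^sub>R y)
      = (\<Sum>\<delta>\<in>D. u (a * disc_sum \<delta> x + (1 - a) * disc_sum \<delta> y) * w \<delta>)"
    unfolding welfare_def by (intro sum.cong) auto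
  have *: "(a * u (disc_sum \<delta> x) + (1 - a) * u (disc_sum \<delta> y)) * w \<delta>
      \<le> u (a * disc_sum \<delta> x + (1 - a) * disc_sum \<delta> y) * w \<delta>" if "\<delta> \<in> D" for \<delta>
    using strictly_concave_weak[OF u(1) a] w(1)[OF that] by (intro mult_right_mono) auto
  then show "a * welfare x + (1 - a) * welfare y \<le> welfare (a *\<^sub>R x + (1 - a) *\<^sub>R y)"
    unfolding eq eq' by (intro sum_mono)
  assume "0 < a" "a < 1" and \<delta>: "\<delta> \<in> D" "disc_sum \<delta> x \<noteq> disc_sum \<delta> y"
  then have "a * u (disc_sum \<delta> x) + (1 - a) * u (disc_sum \<delta> y)
      < u (a * disc_sum \<delta> x + (1 - a) * disc_sum \<delta> y)"
    using u(1) by (auto simp: strictly_concave_def)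
  then have "(a * u (disc_sum \<delta> x) + (1 - a) * u (disc_sum \<delta> y)) * w \<delta>
      < u (a * disc_sum \<delta> x + (1 - a) * disc_sum \<delta> y) * w \<delta>"
    using w(1)[OF \<delta>(1)] by simp
  with * \<delta>(1) show "a * welfare x + (1 - a) * welfare y < welfare (a *\<^sub>R x + (1 - a) *\<^sub>R y)"
    unfolding eq eq' by (intro sum_strict_mono_ex1[OF finite_D]) auto
qed

text \<open>The zero sequence is made indifferent to one with a gain in \<open>p\<close> and a
  balancing loss in \<open>q\<close>; strict concavity favours their midpoint.\<close>

lemma ex_strictly_preferred_mixture:
  assumes pq: "p \<in> D" "q \<in> D" "p \<noteq> q"
  shows "\<exists>x y. welfare x = welfare y \<and> welfare x < welfare ((1 / 2) *\<^sub>R x + (1 - 1 / 2) *\<^sub>R y)"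
proof -
  have cont: "continuous_on A u" for A
    using differentiable_imp_continuous_on[OF u(3)] by (rule continuous_on_subset) auto
  \<comment> \<open>The weighted utility transferred, small enough for the intermediate value
    theorem to realise the gain on [0, 1] and the loss on [-1, 0].\<close>
  define m where "m = min (w p * (u 1 - u 0)) (w q * (u 0 - u (- 1)))"
  have m: "0 < m" "m \<le> w p * (u 1 - u 0)" "m \<le> w q * (u 0 - u (- 1))"
    using w(1) pq strict_monoD[OF u(2), of 0 1] strict_monoD[OF u(2), of "- 1" 0]
    by (auto simp: m_def)
  have "\<exists>h\<ge>0. h \<le> 1 \<and> w p * u h = w p * u 0 + m"
    by (rule IVT') (use m cont in \<open>auto simp: right_diff_distrib intro!: continuous_intros\<close>)
  then obtain h where h: "w p * u h = w p * u 0 + m" by blast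
  have "\<exists>t\<ge>- 1. t \<le> 0 \<and> w q * u t = w q * u 0 - m"
    by (rule IVT') (use m cont in \<open>auto simp: right_diff_distrib intro!: continuous_intros\<close>)
  then obtain t where t: "w q * u t = w q * u 0 - m" by blast
  obtain e where e: "\<And>\<delta> \<delta>'. \<delta> \<in> D \<Longrightarrow> \<delta>' \<in> D \<Longrightarrow> disc_sum \<delta>' (e \<delta>) = (if \<delta>' = \<delta> then 1 else 0)"
    using ex_dual_basis[OF finite_D] by blast
  define x where "x = h *\<^sub>R e p + t *\<^sub>R e q"
  have x: "disc_sum \<delta> x = (if \<delta> = p then h else if \<delta> = q then t else 0)" if "\<delta> \<in> D" for \<delta>
    using that pq by (auto simp: x_def e)
  have z: "disc_sum \<delta> 0 = 0" for \<delta> by (simp add: disc_sum_def)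
  have split: "sum F D = F p + (F q + sum F (D - {p} - {q}))" for F :: "real \<Rightarrow> real"
    using pq finite_D by (simp add: sum.remove[of D p] sum.remove[of "D - {p}" q])
  have "welfare x = welfare 0"
    unfolding welfare_def split using pq h t by (simp add: x z mult.commute)
  moreover have "disc_sum p x \<noteq> disc_sum p 0" using h m(1) pq by (auto simp: x z)
  then have "1 / 2 * welfare x + (1 - 1 / 2) * welfare 0 < welfare ((1 / 2) *\<^sub>R x + (1 - 1 / 2) *\<^sub>R 0)"
    using pq(1) by (intro welfare_concave(2)) auto
  ultimately show ?thesis by (intro exI[of _ x] exI[of _ 0]) simp
qed

text \<open>At a diagonal point \<open>c\<close> the derivative of welfare along \<open>x\<close> is
  \<open>s c * ?M\<close>, whose sign does not depend on \<open>c\<close>. An improvement at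
  \<open>z\<close> forces \<open>?M > 0\<close> by the strict tangent inequality, and then small
  steps improve at \<open>z'\<close>. If all discounted sums of \<open>x\<close> vanish, every step
  leaves welfare unchanged.\<close>

lemma welfare_direction:
  assumes z: "z \<in> linf0" "z' \<in> linf0" and \<alpha>: "0 < \<alpha>" "welfare z \<le> welfare (\<alpha> *\<^sub>R x + z)"
  shows "\<exists>\<beta>>0. welfare z' \<le> welfare (\<beta> *\<^sub>R x + z')"
proof (cases "\<forall>\<delta>\<in>D. disc_sum \<delta> x = 0")
  case True
  then show ?thesis by (intro exI[of _ 1] conjI eq_refl welfare_cong) auto
next
  case False
  then obtain \<delta>0 where \<delta>0: "\<delta>0 \<in> D" "disc_sum \<delta>0 x \<noteq> 0" by blast
  obtain s where s: "\<And>c. (u has_real_derivative s c) (at c)"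
    using u(3) by (metis differentiable_on_def UNIV_I real_differentiable_def)
  have s_pos: "0 < s c" for c
    using supergradient_pos[OF u(2) derivative_supergradient[OF strictly_concave_imp_concave[OF u(1)] s]] .
  let ?M = "\<Sum>\<delta>\<in>D. disc_sum \<delta> x * w \<delta>"
  have W: "welfare (h *\<^sub>R x + z) = (\<Sum>\<delta>\<in>D. u (apply_bcontfun z 0 + h * disc_sum \<delta> x) * w \<delta>)"
    if "z \<in> linf0" for z h
    unfolding welfare_def using that by (intro sum.cong) (auto simp: disc_sum_linf0 add.commute)
  have Wz: "welfare z = u (apply_bcontfun z 0)" if "z \<in> linf0" for z
    using W[OF that, of 0] w(2) by (simp flip: sum_distrib_left)
  define c where "c = apply_bcontfun z 0"
  have tangent: "u (c + \<alpha> * y) \<le> u c + s c * (\<alpha> * y)" "y \<noteq> 0 \<Longrightarrow> u (c + \<alpha> * y) < u c + s c * (\<alpha> * y)" for y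
    using strictly_concave_tangent[OF u(1) s, of "c + \<alpha> * y" c] \<alpha>(1) by (cases "y = 0"; simp)+
  have "welfare (\<alpha> *\<^sub>R x + z) < (\<Sum>\<delta>\<in>D. (u c + s c * (\<alpha> * disc_sum \<delta> x)) * w \<delta>)"
    unfolding W[OF z(1)] c_def[symmetric] using \<delta>0 tangent w(1)
    by (intro sum_strict_mono_ex1[OF finite_D]) (auto intro!: mult_right_mono less_imp_le[OF w(1)])
  also have "\<dots> = u c * sum w D + s c * \<alpha> * ?M"
    by (simp add: sum_distrib_left distrib_right sum.distrib mult.assoc)
  finally have "0 < s c * \<alpha> * ?M" using \<alpha>(2) Wz[OF z(1)] w(2) by (simp add: c_def)
  then have M: "0 < ?M" by (rule zero_less_mult_pos) (use s_pos \<alpha>(1) in simp)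
  define c' where "c' = apply_bcontfun z' 0"
  have du: "((\<lambda>h. u (c' + h * y)) has_real_derivative s c' * y) (at 0)" for y
    by (rule DERIV_chain2[where f = u and g = "\<lambda>h. c' + h * y"]) (auto intro!: s derivative_eq_intros)
  have "((\<lambda>h. \<Sum>\<delta>\<in>D. u (c' + h * disc_sum \<delta> x) * w \<delta>) has_real_derivative
      (\<Sum>\<delta>\<in>D. s c' * disc_sum \<delta> x * w \<delta>)) (at 0)"
    by (intro DERIV_sum DERIV_cmult_right du)
  moreover have "0 < (\<Sum>\<delta>\<in>D. s c' * disc_sum \<delta> x * w \<delta>)"
    using M s_pos[of c'] by (simp add: mult.assoc flip: sum_distrib_left)
  ultimately obtain d where d: "d > 0"
    "\<And>h. 0 < h \<Longrightarrow> h < d \<Longrightarrow> (\<Sum>\<delta>\<in>D. u (c' + 0 * disc_sum \<delta> x) * w \<delta>)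
      < (\<Sum>\<delta>\<in>D. u (c' + (0 + h) * disc_sum \<delta> x) * w \<delta>)"
    using DERIV_pos_inc_right by blast
  have "welfare z' < welfare ((d / 2) *\<^sub>R x + z')"
    using d(2)[of "d / 2"] d(1) W[OF z(2), of 0] W[OF z(2), of "d / 2"] by (simp add: c'_def)
  then show ?thesis using d(1) by (intro exI[of _ "d / 2"]) auto
qed

lemma welfare_unconcerned:
  assumes "\<And>\<delta>. \<delta> \<in> E \<Longrightarrow> disc_sum \<delta> x = disc_sum \<delta> x' \<and> disc_sum \<delta> y = disc_sum \<delta> y'"
    and "\<And>\<delta>. \<delta> \<in> D - E \<Longrightarrow> disc_sum \<delta> x = disc_sum \<delta> y \<and> disc_sum \<delta> x' = disc_sum \<delta> y'"
  shows "welfare x - welfare y = welfare x' - welfare y'"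
  unfolding welfare_def sum_subtractf[symmetric]
proof (rule sum.cong)
  fix \<delta> assume "\<delta> \<in> D"
  then show "u (disc_sum \<delta> x) * w \<delta> - u (disc_sum \<delta> y) * w \<delta>
      = u (disc_sum \<delta> x') * w \<delta> - u (disc_sum \<delta> y') * w \<delta>"
    using assms[of \<delta>] by (cases "\<delta> \<in> E") auto
qed simp

lemma utilitarian_axioms:
  assumes R: "\<And>x y. R x y \<longleftrightarrow> welfare y \<le> welfare x" and pq: "p \<in> D" "q \<in> D" "p \<noteq> q"
  shows "D_monotonicity D R \<and> pref_continuity R \<and> pref_convexity R \<and>
    inv_unconcerned D R \<and> inv_direction_origin0 R"
proof (intro conjI)
  show "D_monotonicity D R"
    unfolding D_monotonicity_def strict_part_def R using welfare_mono by (meson not_le less_imp_le)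
  show "pref_continuity R"
    unfolding pref_continuity_def R
    by (intro allI conjI closed_Collect_le continuous_on_const continuous_welfare)
  show "pref_convexity R"
    unfolding pref_convexity_def
  proof (intro conjI allI impI ballI)
    fix x y \<alpha> assume "indiff_part R x y" and \<alpha>: "\<alpha> \<in> {0..1::real}"
    then have "welfare y = welfare x" by (auto simp: indiff_part_def R)
    moreover have "\<alpha> * welfare x + (1 - \<alpha>) * welfare x = welfare x" by (simp add: algebra_simps)
    ultimately show "R (\<alpha> *\<^sub>R x + (1 - \<alpha>) *\<^sub>R y) x"
      using welfare_concave(1)[of \<alpha> x y] \<alpha> by (simp add: R)
  next
    obtain x y where "welfare x = welfare y"
      "welfare x < welfare ((1 / 2) *\<^sub>R x + (1 - 1 / 2) *\<^sub>R y)"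
      using ex_strictly_preferred_mixture[OF pq] by blast
    then have "indiff_part R x y" "strict_part R ((1 / 2) *\<^sub>R x + (1 - 1 / 2) *\<^sub>R y) x"
      by (simp_all add: indiff_part_def strict_part_def R)
    then show "\<exists>x y. indiff_part R x y \<and>
        (\<exists>\<alpha>\<in>{0<..<1}. strict_part R (\<alpha> *\<^sub>R x + (1 - \<alpha>) *\<^sub>R y) x)"
      by (intro exI[of _ x] exI[of _ y] conjI bexI[of _ "1 / 2"]) auto
  qed
  show "inv_unconcerned D R"
    unfolding inv_unconcerned_def
  proof (intro allI impI)
    fix x y x' y' E
    assume "\<forall>\<delta>\<in>E. disc_sum \<delta> x = disc_sum \<delta> x' \<and> disc_sum \<delta> y = disc_sum \<delta> y'"
      "\<forall>\<delta>\<in>D - E. disc_sum \<delta> x = disc_sum \<delta> y \<and> disc_sum \<delta> x' = disc_sum \<delta> y'"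
    then have "welfare x - welfare y = welfare x' - welfare y'"
      by (intro welfare_unconcerned[where E = E]) auto
    then show "R x y \<longleftrightarrow> R x' y'" unfolding R by linarith
  qed
  show "inv_direction_origin0 R"
    unfolding inv_direction_origin0_def R using welfare_direction by blast
qed

end

section \<open>The axioms imply the representation\<close>

lemma ex_pmf_of_weights:
  fixes w :: "'a \<Rightarrow> real"
  assumes D: "finite D" and w: "\<And>i. i \<in> D \<Longrightarrow> 0 < w i" "sum w D = 1"
  shows "\<exists>\<mu>\<in>full_support_measures D. \<forall>i\<in>D. pmf \<mu> i = w i"
proof -
  let ?f = "\<lambda>i. if i \<in> D then w i else 0"
  have nn: "0 \<le> ?f i" for i using w(1)[of i] by (simp add: less_imp_le)
  have "(\<integral>\<^sup>+ i. ennreal (?f i) \<partial>count_space UNIV) = (\<Sum>i\<in>D. ennreal (?f i))"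
    using D by (intro nn_integral_count_space') auto
  also have "\<dots> = ennreal (\<Sum>i\<in>D. ?f i)" using nn by (intro sum_ennreal)
  finally have "(\<integral>\<^sup>+ i. ennreal (?f i) \<partial>count_space UNIV) = 1" using w(2) by simp
  then have pmf: "pmf (embed_pmf ?f) i = ?f i" for i using nn by (intro pmf_embed_pmf) auto
  then have "embed_pmf ?f \<in> full_support_measures D"
    using w(1) by (auto simp: full_support_measures_def set_pmf_iff split: if_splits)
  then show ?thesis using pmf by (intro bexI[of _ "embed_pmf ?f"]) auto
qed

text \<open>By D-monotonicity \<open>R\<close> depends only on the discounted sums over
  \<open>D\<close>, so it descends to a preference \<open>P\<close> on vectors indexed by
  \<open>D\<close>, where \<open>concave_representation\<close> applies.\<close>

lemma axioms_imp_representation: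
  fixes D :: "real set" and R :: "linf \<Rightarrow> linf \<Rightarrow> bool"
  assumes finite_D: "finite D" and card_D: "3 \<le> card D" and D: "D \<subseteq> {0<..<1}"
    and weak: "weak_order R" and mono: "D_monotonicity D R" and cont: "pref_continuity R"
    and conv: "pref_convexity R" and inv: "inv_unconcerned D R" and dir: "inv_direction_origin0 R"
  shows "\<exists>(u :: real \<Rightarrow> real) w. strictly_concave u \<and> strict_mono u \<and> u differentiable_on UNIV \<and>
    (\<forall>\<delta>\<in>D. 0 < w \<delta>) \<and> sum w D = 1 \<and>
    (\<forall>x y. R x y \<longleftrightarrow> (\<Sum>\<delta>\<in>D. u (disc_sum \<delta> y) * w \<delta>) \<le> (\<Sum>\<delta>\<in>D. u (disc_sum \<delta> x) * w \<delta>))"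
proof -
  have total: "R x y \<or> R y x" and trans: "R x y \<Longrightarrow> R y z \<Longrightarrow> R x z" for x y z
    using weak unfolding weak_order_def by blast+
  have R_mono: "R x y" if "\<And>\<delta>. \<delta> \<in> D \<Longrightarrow> disc_sum \<delta> y \<le> disc_sum \<delta> x" for x y
    using mono that unfolding D_monotonicity_def by blast
  have R_cong: "R x y \<longleftrightarrow> R x' y'"
    if "\<And>\<delta>. \<delta> \<in> D \<Longrightarrow> disc_sum \<delta> x = disc_sum \<delta> x'" "\<And>\<delta>. \<delta> \<in> D \<Longrightarrow> disc_sum \<delta> y = disc_sum \<delta> y'" for x y x' y'
    using R_mono[of x x'] R_mono[of x' x] R_mono[of y y'] R_mono[of y' y] trans that by (metis order_refl)
  obtain e where e: "\<And>\<delta> \<delta>'. \<delta> \<in> D \<Longrightarrow> \<delta>' \<in> D \<Longrightarrow> disc_sum \<delta>' (e \<delta>) = (if \<delta>' = \<delta> then 1 else 0)"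
    using ex_dual_basis[OF finite_D] by blast
  \<comment> \<open>A linear right inverse, on \<open>D\<close>, of the map to discounted sums,
    built from the dual basis. Linearity sends lines to lines, which carries closedness over to
    \<open>P\<close>.\<close>
  define lift where "lift X = (\<Sum>\<delta>\<in>D. X \<delta> *\<^sub>R e \<delta>)" for X :: "real \<Rightarrow> real"
  have ds: "disc_sum \<delta> (x + y) = disc_sum \<delta> x + disc_sum \<delta> y"
    "disc_sum \<delta> (r *\<^sub>R x) = r * disc_sum \<delta> x" if "\<delta> \<in> D" for \<delta> x y r
    using D that disc_sum_add disc_sum_scaleR by blast+
  have lift: "disc_sum \<delta> (lift X) = X \<delta>" if "\<delta> \<in> D" for \<delta> X
  proof -
    have "linear (disc_sum \<delta>)"
      using D that by (intro bounded_linear.linear bounded_linear_disc_sum) auto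
    then have "disc_sum \<delta> (lift X) = (\<Sum>\<delta>'\<in>D. X \<delta>' * disc_sum \<delta> (e \<delta>'))"
      unfolding lift_def by (simp add: linear_sum ds that)
    also have "\<dots> = (\<Sum>\<delta>'\<in>D. if \<delta>' = \<delta> then X \<delta> else 0)"
      using that by (intro sum.cong) (auto simp: e)
    also have "\<dots> = X \<delta>" using finite_D that by simp
    finally show ?thesis .
  qed
  define P where "P X Y = R (lift X) (lift Y)" for X Y
  have PR: "P X Y \<longleftrightarrow> R x y"
    if "\<And>\<delta>. \<delta> \<in> D \<Longrightarrow> disc_sum \<delta> x = X \<delta>" "\<And>\<delta>. \<delta> \<in> D \<Longrightarrow> disc_sum \<delta> y = Y \<delta>" for X Y x y
    unfolding P_def by (rule R_cong) (simp_all add: lift that)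
  have line: "continuous_on UNIV (\<lambda>t. lift X + t *\<^sub>R lift V)" for X V
    by (intro continuous_intros)
  have P_line: "P (\<lambda>i. X i + t * V i) Y \<longleftrightarrow> R (lift X + t *\<^sub>R lift V) (lift Y)"
    "P Y (\<lambda>i. X i + t * V i) \<longleftrightarrow> R (lift Y) (lift X + t *\<^sub>R lift V)" for X V Y t
    by (rule PR; simp add: lift ds)+
  interpret separable_preference D P
  proof
    show "finite D" "3 \<le> card D" by fact+
    show "P X Y \<or> P Y X" for X Y unfolding P_def by (rule total)
    show "P X Z" if "P X Y" "P Y Z" for X Y Z using that unfolding P_def by (rule trans)
    show "P X Y" if "\<And>i. i \<in> D \<Longrightarrow> Y i \<le> X i" for X Y
      unfolding P_def by (rule R_mono) (simp add: lift that)
    show "\<not> P Y X" if "\<And>i. i \<in> D \<Longrightarrow> Y i \<le> X i" "k \<in> D" "Y k < X k" for X Y k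
    proof -
      have "\<forall>\<delta>\<in>D. disc_sum \<delta> (lift Y) \<le> disc_sum \<delta> (lift X)"
        "\<exists>\<delta>\<in>D. disc_sum \<delta> (lift Y) < disc_sum \<delta> (lift X)" using that by (auto simp: lift)
      then show ?thesis using mono unfolding D_monotonicity_def strict_part_def P_def by blast
    qed
    show "closed {t. P (\<lambda>i. X i + t * V i) Y}" for X V Y
    proof -
      have "closed {z. R z (lift Y)}" using cont by (simp add: pref_continuity_def)
      from closed_vimage[OF this line] show ?thesis by (simp add: P_line vimage_def)
    qed
    show "closed {t. P Y (\<lambda>i. X i + t * V i)}" for X V Y
    proof -
      have "closed {z. R (lift Y) z}" using cont by (simp add: pref_continuity_def)
      from closed_vimage[OF this line] show ?thesis by (simp add: P_line vimage_def)
    qed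
    show "P (\<lambda>i. a * X i + (1 - a) * Y i) X" if "P X Y" "P Y X" "0 \<le> a" "a \<le> 1" for X Y a
    proof -
      have "R (a *\<^sub>R lift X + (1 - a) *\<^sub>R lift Y) (lift X)"
        using conv that unfolding pref_convexity_def indiff_part_def P_def by auto
      then show ?thesis by (subst PR) (simp_all add: lift ds)
    qed
    \<comment> \<open>The concerned set is \<open>D - {k}\<close>: there the changed and unchanged
      vectors agree, while at \<open>k\<close> the two compared vectors agree.\<close>
    show "P (X(k := t)) (Y(k := t)) \<longleftrightarrow> P X Y" if k: "k \<in> D" "X k = Y k" for k X Y t
      unfolding P_def
      by (rule inv[unfolded inv_unconcerned_def, rule_format, of "D - {k}"])
        (use k in \<open>auto simp: lift\<close>)
  qed
  have direction: "\<forall>\<alpha> c X c'. 0 < \<alpha> \<longrightarrow> P (\<lambda>i. c + \<alpha> * X i) (\<lambda>_. c) \<longrightarrow>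
      (\<exists>\<beta>>0. P (\<lambda>i. c' + \<beta> * X i) (\<lambda>_. c'))"
  proof (intro allI impI)
    fix \<alpha> c X c' assume \<alpha>: "0 < \<alpha>" "P (\<lambda>i. c + \<alpha> * X i) (\<lambda>_. c)"
    \<comment> \<open>Sequences in \<open>linf0\<close> have the same discounted sum for every
      factor, so \<open>z\<close> and \<open>z'\<close> realise the constant vectors
      \<open>c\<close> and \<open>c'\<close>.\<close>
    obtain z z' where z: "z \<in> linf0" "apply_bcontfun z 0 = c" "z' \<in> linf0" "apply_bcontfun z' 0 = c'"
      using ex_linf0 by metis
    have PRz: "P (\<lambda>i. c + \<alpha> * X i) (\<lambda>_. c) \<longleftrightarrow> R (\<alpha> *\<^sub>R lift X + z) z"
      if "z \<in> linf0" "apply_bcontfun z 0 = c" for z c \<alpha>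
      by (rule PR) (simp_all add: lift ds disc_sum_linf0 that)
    show "\<exists>\<beta>>0. P (\<lambda>i. c' + \<beta> * X i) (\<lambda>_. c')"
      using dir \<alpha> z unfolding inv_direction_origin0_def by (metis PRz)
  qed
  obtain x y a where xy: "R x y" "R y x" "\<not> R x (a *\<^sub>R x + (1 - a) *\<^sub>R y)"
    using conv unfolding pref_convexity_def indiff_part_def strict_part_def by blast
  let ?v = "\<lambda>x \<delta>. disc_sum \<delta> x"
  have "P (?v x) (?v y)" "P (?v y) (?v x)" "\<not> P (?v x) (\<lambda>i. a * ?v x i + (1 - a) * ?v y i)"
    using xy PR[of x "?v x" y "?v y"] PR[of y "?v y" x "?v x"]
      PR[of x "?v x" "a *\<^sub>R x + (1 - a) *\<^sub>R y" "\<lambda>i. a * ?v x i + (1 - a) * ?v y i"] by (auto simp: ds)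
  from concave_representation[OF direction this]
  obtain u :: "real \<Rightarrow> real" and w where uw: "strictly_concave u" "strict_mono u" "u differentiable_on UNIV"
    "\<forall>i\<in>D. 0 < w i" "sum w D = 1"
    "\<And>X Y. P X Y \<longleftrightarrow> (\<Sum>i\<in>D. u (Y i) * w i) \<le> (\<Sum>i\<in>D. u (X i) * w i)" by blast
  have "R x y \<longleftrightarrow> P (?v x) (?v y)" for x y using PR[of x "?v x" y "?v y"] by simp
  with uw show ?thesis by (intro exI[of _ u] exI[of _ w]) simp
qed

theorem theorem4p1:
  fixes N :: nat and d :: "nat \<Rightarrow> real" and D :: "real set"
    and R :: "linf \<Rightarrow> linf \<Rightarrow> bool"
  assumes "N \<ge> 3"
    and "D = d ` {1..N}" and "inj_on d {1..N}"
    and "D \<subseteq> {0<..<1}"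
    and "weak_order R"
  shows "(D_monotonicity D R \<and> pref_continuity R \<and> pref_convexity R \<and>
          inv_unconcerned D R \<and> inv_direction_origin0 R) \<longleftrightarrow>
         (\<exists>u :: real \<Rightarrow> real. \<exists>\<mu> \<in> full_support_measures D.
            strictly_concave u \<and> strict_mono u \<and> u differentiable_on UNIV \<and>
            (\<forall>x y. R x y \<longleftrightarrow>
               (\<Sum>\<delta>\<in>D. u (disc_sum \<delta> x) * pmf \<mu> \<delta>) \<ge> (\<Sum>\<delta>\<in>D. u (disc_sum \<delta> y) * pmf \<mu> \<delta>)))"
    (is "?axioms \<longleftrightarrow> ?representation")
proof
  have finite_D: "finite D" and card_D: "3 \<le> card D"
    using assms(1-3) by (simp_all add: card_image)
  show ?representation if ?axioms
  proof -
    have "D_monotonicity D R" "pref_continuity R" "pref_convexity R"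
      "inv_unconcerned D R" "inv_direction_origin0 R" using that by simp_all
    from axioms_imp_representation[OF finite_D card_D assms(4,5) this]
    obtain u :: "real \<Rightarrow> real" and w where uw: "strictly_concave u" "strict_mono u" "u differentiable_on UNIV"
      "\<forall>\<delta>\<in>D. 0 < w \<delta>" "sum w D = 1"
      "\<forall>x y. R x y \<longleftrightarrow> (\<Sum>\<delta>\<in>D. u (disc_sum \<delta> y) * w \<delta>) \<le> (\<Sum>\<delta>\<in>D. u (disc_sum \<delta> x) * w \<delta>)"
      by blast
    obtain \<mu> where \<mu>: "\<mu> \<in> full_support_measures D" "\<forall>\<delta>\<in>D. pmf \<mu> \<delta> = w \<delta>"
      using ex_pmf_of_weights[OF finite_D uw(4)[rule_format] uw(5)] by blast
    show ?thesis using uw(1-3,6) \<mu> by (intro exI[of _ u] bexI[of _ \<mu>]) simp_all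
  qed
  show ?axioms if representation: ?representation
  proof -
    from representation obtain u \<mu> where u: "strictly_concave u" "strict_mono u" "u differentiable_on UNIV"
      and \<mu>: "\<mu> \<in> full_support_measures D"
      and rep: "\<forall>x y. R x y \<longleftrightarrow>
        (\<Sum>\<delta>\<in>D. u (disc_sum \<delta> x) * pmf \<mu> \<delta>) \<ge> (\<Sum>\<delta>\<in>D. u (disc_sum \<delta> y) * pmf \<mu> \<delta>)"
      by blast
    interpret utilitarian D u "pmf \<mu>"
      using finite_D assms(4) u \<mu> by unfold_locales (auto simp: full_support_measures_def sum_pmf_eq_1)
    obtain p q where "p \<in> D" "q \<in> D" "p \<noteq> q"
      using obtain_subset_with_card_n[OF card_D] by (metis card_3_iff insert_subset)
    then show ?thesis using rep by (intro utilitarian_axioms) (auto simp: welfare_def)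
  qed
qed

end
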